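(* Let $X$ be a Tychonoff space. Then the family \[ \mathcal{B}=\left\{ \sum_{n\in\mathbb{N}} V_{n} + \sum_{n\in\mathbb{N}} \frac{1}{\phi_n} X : \{V_{n}\}_{n\in\mathbb{N}}\subseteq \mathcal{U}_X,\ \{\phi_n\}_{n\in\mathbb{N}}\subseteq \mathbb{N}^X\right\} \] is a neighbourhood base at zero of the free topological vector space $\mathbb{V}(X)$ over $X$, and the family \[ \mathcal{B}_L=\{ \mathrm{conv}(W): W\in\mathcal{B}\} \] is a neighbourhood base at zero of the free locally convex space $L(X)$ over $X$. Moreover, if $X$ is pseudocompact, then all functions $\phi_n$ can be chosen to be constant; that is, for pseudocompact $X$ both assertions remain true when $\mathcal{B}$ is replaced by its subfamily consisting of those sets $\sum_{n\in\mathbb{N}} V_{n} + \sum_{n\in\mathbb{N}} \frac{1}{\phi_n} X$ for which every $\phi_n$ is a constant function (and $\mathcal{B}_L$ by the family of convex hulls of the members of this subfamily).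
   Context: Notation: $\mathbb{N}=\{1,2,\dots\}$; $\mathbb{N}^X$ is the set of all functions (not necessarily continuous) from $X$ to $\mathbb{N}$; $\mathcal{U}_X$ is the universal uniformity of the Tychonoff space $X$, i.e. the finest uniformity on the set $X$ inducing the topology of $X$, and its members are entourages $V\subseteq X\times X$. Vector spaces are over the field of real numbers. A Tychonoff space is pseudocompact if every continuous real-valued function on it is bounded. $\mathrm{conv}(W)$ denotes the convex hull of $W$, and $A+B=\{a+b: a\in A,\ b\in B\}$. Free topological vector space: the free topological vector space $\mathbb{V}(X)$ over $X$ is a pair consisting of a topological vector space $\mathbb{V}(X)$ and a continuous map $i: X\to\mathbb{V}(X)$ such that every continuous map $f$ from $X$ to a topological vector space $E$ gives rise to a unique continuous linear operator $\bar f:\mathbb{V}(X)\to E$ with $f=\bar f\circ i$. Free locally convex space: the free locally convex space $L(X)$ over $X$ is a pair consisting of a locally convex space $L(X)$ and a continuous map $i: X\to L(X)$ such that every continuous map $f$ from $X$ to a locally convex space $E$ gives rise to a unique continuous linear operator $\Psi_E(f): L(X)\to E$ with $f=\Psi_E(f)\circ i$. Both objects exist and are unique up to isomorphism. The underlying vector space of both is the vector space $\mathbb{V}_X$ with basis $X$ (the map $i$ being the inclusion $X\subseteq\mathbb{V}_X$ of the basis), so $\mathbb{V}(X)=(\mathbb{V}_X,\pmb{\mu}_X)$ and $L(X)=(\mathbb{V}_X,\pmb{\nu}_X)$ for topologies $\pmb{\mu}_X$ and $\pmb{\nu}_X$ on $\mathbb{V}_X$. The infinite sums are the following subsets of $\mathbb{V}_X$.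 For a sequence $\{V_n\}_{n\in\mathbb{N}}$ of members of $\mathcal{U}_X$, \[ \sum_{n\in\mathbb{N}} V_{n} := \bigcup_{m\in\mathbb{N}} \left\{ \sum_{n=1}^m t_n (x_n-y_n): |t_n|\leq 1 \text{ and } (x_n,y_n)\in V_{n} \text{ for all } n\leq m\right\}, \] and for a sequence $\{\phi_n\}_{n\in\mathbb{N}}$ in $\mathbb{N}^X$, \[ \sum_{n\in\mathbb{N}} \frac{1}{\phi_n} X := \bigcup_{m\in\mathbb{N}} \left\{ \sum_{n=1}^m t_n x_n: x_n \in X \text{ and } |t_n| \leq \frac{1}{\phi_n(x_n)} \text{ for all } n\leq m \right\}, \] where the $t_n$ are real scalars and the differences and linear combinations are taken in $\mathbb{V}_X$. *)

theory Defs
  imports "HOL-Analysis.Analysis" "HOL-Analysis.Finite_Function_Topology"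
begin

section \<open>The universal uniformity\<close>

definition uniformity_of_set :: "'a set \<Rightarrow> ('a \<times> 'a) set set \<Rightarrow> bool" where
  "uniformity_of_set S \<U> \<longleftrightarrow>
     \<U> \<noteq> {} \<and>
     (\<forall>V\<in>\<U>. Id_on S \<subseteq> V \<and> V \<subseteq> S \<times> S) \<and>
     (\<forall>V\<in>\<U>. \<forall>W. V \<subseteq> W \<and> W \<subseteq> S \<times> S \<longrightarrow> W \<in> \<U>) \<and>
     (\<forall>V\<in>\<U>. \<forall>W\<in>\<U>. V \<inter> W \<in> \<U>) \<and>
     (\<forall>V\<in>\<U>. V\<inverse> \<in> \<U>) \<and>
     (\<forall>V\<in>\<U>. \<exists>W\<in>\<U>. W O W \<subseteq> V)"

definition compatible_uniformity :: "'a topology \<Rightarrow> ('a \<times> 'a) set set \<Rightarrow> bool" where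
  "compatible_uniformity X \<U> \<longleftrightarrow>
     uniformity_of_set (topspace X) \<U> \<and>
     (\<forall>U. openin X U \<longleftrightarrow> U \<subseteq> topspace X \<and> (\<forall>x\<in>U. \<exists>V\<in>\<U>. V `` {x} \<subseteq> U))"

definition universal_uniformity :: "'a topology \<Rightarrow> ('a \<times> 'a) set set" where
  "universal_uniformity X =
     (THE \<U>. compatible_uniformity X \<U> \<and>
             (\<forall>\<W>. compatible_uniformity X \<W> \<longrightarrow> \<W> \<subseteq> \<U>))"

definition pseudocompact_space :: "'a topology \<Rightarrow> bool" where
  "pseudocompact_space X \<longleftrightarrow>
     (\<forall>f. continuous_map X euclideanreal f \<longrightarrow> bounded (f ` topspace X))"


section \<open>Topological vector spaces\<close>

text \<open>A real topological vector space is a topology whose underlying set is a linear subspace of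
  some type of class \<open>real_vector\<close>. No separation axiom is required.\<close>

definition tvs :: "'e::real_vector topology \<Rightarrow> bool" where
  "tvs E \<longleftrightarrow>
     subspace (topspace E) \<and>
     continuous_map (prod_topology E E) E (\<lambda>(u, v). u + v) \<and>
     continuous_map (prod_topology euclideanreal E) E (\<lambda>(c, u). c *\<^sub>R u)"

definition lcs :: "'e::real_vector topology \<Rightarrow> bool" where
  "lcs E \<longleftrightarrow> tvs E \<and> neighbourhood_base_at 0 convex E"

definition linear_between ::
    "'v::real_vector set \<Rightarrow> 'w::real_vector set \<Rightarrow> ('v \<Rightarrow> 'w) \<Rightarrow> bool" where
  "linear_between S T g \<longleftrightarrow>
     g ` S \<subseteq> T \<and>
     (\<forall>u\<in>S. \<forall>v\<in>S. g (u + v) = g u + g v) \<and>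
     (\<forall>c. \<forall>u\<in>S. g (c *\<^sub>R u) = c *\<^sub>R g u)"


section \<open>Free topological vector spaces and free locally convex spaces\<close>

abbreviation gen :: "'a \<Rightarrow> 'a \<Rightarrow>\<^sub>0 real" where
  "gen x \<equiv> Poly_Mapping.single x 1"

definition free_vector_space :: "'a set \<Rightarrow> ('a \<Rightarrow>\<^sub>0 real) set" where
  "free_vector_space S = {p. Poly_Mapping.keys p \<subseteq> S}"

text \<open>The operators are taken in \<open>extensional\<close> because only their values on the domain matter for
  uniqueness.\<close>

definition uniquely_extends ::
    "'a topology \<Rightarrow> ('a \<Rightarrow>\<^sub>0 real) topology \<Rightarrow> 'e::real_vector topology \<Rightarrow> bool" where
  "uniquely_extends X \<mu> E \<longleftrightarrow>
     (\<forall>f. continuous_map X E f \<longrightarrow>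
        (\<exists>!g. g \<in> extensional (topspace \<mu>) \<and>
              linear_between (topspace \<mu>) (topspace E) g \<and>
              continuous_map \<mu> E g \<and>
              (\<forall>x\<in>topspace X. g (gen x) = f x)))"

text \<open>The universal property with respect to a class \<open>C\<close> of topological vector spaces. A
  definition cannot quantify over types, so the test spaces range over the linear subspaces of
  \<open>'a \<Rightarrow>\<^sub>0 real\<close>. This is no restriction: the theorems \<open>free_tvs_universal\<close> and
  \<open>free_lcs_universal\<close> below give the universal property for test spaces of every type.\<close>

definition free_over ::
    "(('a \<Rightarrow>\<^sub>0 real) topology \<Rightarrow> bool) \<Rightarrow> 'a topology \<Rightarrow> ('a \<Rightarrow>\<^sub>0 real) topology \<Rightarrow> bool" where
  "free_over C X \<mu> \<longleftrightarrow>
     C \<mu> \<and> topspace \<mu> = free_vector_space (topspace X) \<and> continuous_map X \<mu> gen \<and>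
     (\<forall>E. C E \<longrightarrow> uniquely_extends X \<mu> E)"

definition free_tvs :: "'a topology \<Rightarrow> ('a \<Rightarrow>\<^sub>0 real) topology" where
  "free_tvs X = (THE \<mu>. free_over tvs X \<mu>)"

definition free_lcs :: "'a topology \<Rightarrow> ('a \<Rightarrow>\<^sub>0 real) topology" where
  "free_lcs X = (THE \<nu>. free_over lcs X \<nu>)"


section \<open>The infinite sums\<close>

text \<open>Sequences are indexed by the positive integers: the values at index \<open>0\<close> are never used.\<close>

definition entourage_sum :: "(nat \<Rightarrow> ('a \<times> 'a) set) \<Rightarrow> ('a \<Rightarrow>\<^sub>0 real) set" where
  "entourage_sum V =
     (\<Union>m\<in>{1..}. {(\<Sum>n=1..m. t n *\<^sub>R (gen (x n) - gen (y n))) | t x y.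
                   \<forall>n\<in>{1..m}. \<bar>t n\<bar> \<le> 1 \<and> (x n, y n) \<in> V n})"

definition reciprocal_sum :: "'a set \<Rightarrow> (nat \<Rightarrow> 'a \<Rightarrow> nat) \<Rightarrow> ('a \<Rightarrow>\<^sub>0 real) set" where
  "reciprocal_sum S \<phi> =
     (\<Union>m\<in>{1..}. {(\<Sum>n=1..m. t n *\<^sub>R gen (x n)) | t x.
                   \<forall>n\<in>{1..m}. x n \<in> S \<and> \<bar>t n\<bar> \<le> 1 / real (\<phi> n (x n))})"

definition base_family :: "'a topology \<Rightarrow> ('a \<Rightarrow>\<^sub>0 real) set set" where
  "base_family X =
     {entourage_sum V + reciprocal_sum (topspace X) \<phi> | V \<phi>.
        (\<forall>n\<ge>1. V n \<in> universal_uniformity X) \<and>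
        (\<forall>n\<ge>1. \<forall>x\<in>topspace X. \<phi> n x \<ge> 1)}"

definition base_family_const :: "'a topology \<Rightarrow> ('a \<Rightarrow>\<^sub>0 real) set set" where
  "base_family_const X =
     {entourage_sum V + reciprocal_sum (topspace X) \<phi> | V \<phi>.
        (\<forall>n\<ge>1. V n \<in> universal_uniformity X) \<and>
        (\<forall>n\<ge>1. \<forall>x\<in>topspace X. \<phi> n x \<ge> 1) \<and>
        (\<forall>n\<ge>1. \<exists>k. \<forall>x\<in>topspace X. \<phi> n x = k)}"

text \<open>The members of a neighbourhood base are neighbourhoods, not necessarily open sets.\<close>

definition nhood_base_at :: "'b topology \<Rightarrow> 'b \<Rightarrow> 'b set set \<Rightarrow> bool" where
  "nhood_base_at T a \<B> \<longleftrightarrow>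
     (\<forall>B\<in>\<B>. B \<subseteq> topspace T \<and> (\<exists>U. openin T U \<and> a \<in> U \<and> U \<subseteq> B)) \<and>
     (\<forall>U. openin T U \<and> a \<in> U \<longrightarrow> (\<exists>B\<in>\<B>. B \<subseteq> U))"


section \<open>Existence, uniqueness and universality of the free objects\<close>

definition lin_ext :: "('a \<Rightarrow> 'e::real_vector) \<Rightarrow> ('a \<Rightarrow>\<^sub>0 real) \<Rightarrow> 'e" where
  "lin_ext f p = (\<Sum>x\<in>Poly_Mapping.keys p. Poly_Mapping.lookup p x *\<^sub>R f x)"

lemma lookup_scaleR_real [simp]:
  "Poly_Mapping.lookup (c *\<^sub>R p) x = c * Poly_Mapping.lookup (p :: 'a \<Rightarrow>\<^sub>0 real) x"
proof -
  have "finite {i. c *\<^sub>R Poly_Mapping.lookup p i \<noteq> 0}"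
    by (rule finite_subset[OF _ finite_lookup[of p]]) auto
  then show ?thesis by (simp add: scaleR_poly_mapping_def)
qed

lemma lin_ext_superset:
  assumes "finite A" "Poly_Mapping.keys p \<subseteq> A"
  shows "lin_ext f p = (\<Sum>x\<in>A. Poly_Mapping.lookup p x *\<^sub>R f x)"
  unfolding lin_ext_def
  by (rule sum.mono_neutral_left) (use assms in \<open>auto simp: in_keys_iff\<close>)

lemma lin_ext_add: "lin_ext f (p + q) = lin_ext f p + lin_ext f q"
proof -
  let ?A = "Poly_Mapping.keys p \<union> Poly_Mapping.keys q"
  have "finite ?A" by simp
  then show ?thesis
    using lin_ext_superset[of ?A p f] lin_ext_superset[of ?A q f]
      lin_ext_superset[of ?A "p + q" f] keys_add[of p q]
    by (simp add: lookup_add scaleR_add_left sum.distrib)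
qed

lemma lin_ext_scaleR: "lin_ext f (c *\<^sub>R p) = c *\<^sub>R lin_ext f p"
proof -
  have "Poly_Mapping.keys (c *\<^sub>R p) \<subseteq> Poly_Mapping.keys p" by (auto simp: in_keys_iff)
  then show ?thesis
    using lin_ext_superset[of "Poly_Mapping.keys p" "c *\<^sub>R p" f]
    by (simp add: lin_ext_def scaleR_sum_right)
qed

lemma lin_ext_gen [simp]: "lin_ext f (gen x) = f x"
  by (simp add: lin_ext_def)

lemma lin_ext_in:
  assumes "subspace T" "f ` S \<subseteq> T" "p \<in> free_vector_space S"
  shows "lin_ext f p \<in> T"
  unfolding lin_ext_def
  by (rule subspace_sum[OF assms(1)], rule subspace_scale[OF assms(1)])
    (use assms(2,3) in \<open>auto simp: free_vector_space_def\<close>)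

lemma gen_in_free_vector_space: "x \<in> S \<Longrightarrow> gen x \<in> free_vector_space S"
  by (simp add: free_vector_space_def)

lemma subspace_free_vector_space: "subspace (free_vector_space S)"
proof (rule subspaceI)
  show "p + q \<in> free_vector_space S" if "p \<in> free_vector_space S" "q \<in> free_vector_space S" for p q
    using that keys_add[of p q] by (auto simp: free_vector_space_def)
  show "c *\<^sub>R p \<in> free_vector_space S" if "p \<in> free_vector_space S" for c p
    using that by (auto simp: free_vector_space_def in_keys_iff)
qed (simp add: free_vector_space_def)

lemma lin_ext_gen_eq: "lin_ext gen p = p"
proof (rule poly_mapping_eqI)
  fix k
  have "Poly_Mapping.lookup (lin_ext gen p) k
      = (\<Sum>x\<in>Poly_Mapping.keys p. if x = k then Poly_Mapping.lookup p x else 0)"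
    unfolding lin_ext_def lookup_sum by (rule sum.cong) (simp_all add: lookup_single when_def)
  then show "Poly_Mapping.lookup (lin_ext gen p) k = Poly_Mapping.lookup p k"
    by (simp add: in_keys_iff)
qed

lemma linear_between_sum:
  assumes "linear_between S T g" "subspace S" "finite A" "\<And>x. x \<in> A \<Longrightarrow> u x \<in> S"
  shows "g (\<Sum>x\<in>A. c x *\<^sub>R u x) = (\<Sum>x\<in>A. c x *\<^sub>R g (u x))"
  using assms(3,4)
proof (induction A rule: finite_induct)
  case empty
  have "g (0 *\<^sub>R 0) = 0 *\<^sub>R g 0"
    using assms(1) subspace_0[OF assms(2)] unfolding linear_between_def by blast
  then show ?case by simp
next
  case (insert a A)
  have "c a *\<^sub>R u a \<in> S" "(\<Sum>x\<in>A. c x *\<^sub>R u x) \<in> S"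
    using insert.prems assms(2) by (auto intro!: subspace_sum subspace_scale)
  then show ?case
    using insert assms(1) by (simp add: linear_between_def)
qed

lemma linear_between_eq_lin_ext:
  assumes "linear_between (free_vector_space S) T g" "p \<in> free_vector_space S"
    "\<And>x. x \<in> S \<Longrightarrow> g (gen x) = f x"
  shows "g p = lin_ext f p"
proof -
  have k: "Poly_Mapping.keys p \<subseteq> S" using assms(2) by (simp add: free_vector_space_def)
  have "g p = g (\<Sum>x\<in>Poly_Mapping.keys p. Poly_Mapping.lookup p x *\<^sub>R gen x)"
    by (fold lin_ext_def) (simp add: lin_ext_gen_eq)
  also have "\<dots> = (\<Sum>x\<in>Poly_Mapping.keys p. Poly_Mapping.lookup p x *\<^sub>R g (gen x))"
    by (rule linear_between_sum[OF assms(1) subspace_free_vector_space])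
      (use k in \<open>auto intro: gen_in_free_vector_space\<close>)
  also have "\<dots> = lin_ext f p"
    unfolding lin_ext_def by (rule sum.cong) (use k assms(3) in auto)
  finally show ?thesis .
qed

lemma uniquely_extendsI:
  assumes "topspace \<mu> = free_vector_space (topspace X)" "subspace (topspace E)"
    and "\<And>f. continuous_map X E f \<Longrightarrow> continuous_map \<mu> E (lin_ext f)"
  shows "uniquely_extends X \<mu> E"
  unfolding uniquely_extends_def
proof (intro allI impI)
  fix f assume f: "continuous_map X E f"
  let ?S = "topspace \<mu>"
  let ?g = "restrict (lin_ext f) ?S"
  have fim: "f ` topspace X \<subseteq> topspace E" using f continuous_map_image_subset_topspace by blast
  have sub: "subspace ?S" by (simp add: assms(1) subspace_free_vector_space)
  have lin: "linear_between ?S (topspace E) ?g"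
    using lin_ext_in[OF assms(2) fim] sub subspace_add[OF sub] subspace_scale[OF sub]
    by (auto simp: linear_between_def assms(1) lin_ext_add lin_ext_scaleR)
  have cont: "continuous_map \<mu> E ?g"
    using assms(3)[OF f] by (rule continuous_map_eq) auto
  show "\<exists>!g. g \<in> extensional ?S \<and> linear_between ?S (topspace E) g \<and>
          continuous_map \<mu> E g \<and> (\<forall>x\<in>topspace X. g (gen x) = f x)"
  proof (rule ex1I[of _ ?g])
    show "?g \<in> extensional ?S \<and> linear_between ?S (topspace E) ?g \<and>
          continuous_map \<mu> E ?g \<and> (\<forall>x\<in>topspace X. ?g (gen x) = f x)"
      using lin cont by (auto simp: assms(1) gen_in_free_vector_space)
  next
    fix g assume g: "g \<in> extensional ?S \<and> linear_between ?S (topspace E) g \<and>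
          continuous_map \<mu> E g \<and> (\<forall>x\<in>topspace X. g (gen x) = f x)"
    show "g = ?g"
    proof (rule extensionalityI[of _ ?S])
      fix p assume p: "p \<in> ?S"
      then show "g p = ?g p"
        using linear_between_eq_lin_ext[of "topspace X" "topspace E" g p f] g
        by (simp add: assms(1))
    qed (use g in auto)
  qed
qed

lemma uniquely_extendsD:
  assumes "topspace \<mu> = free_vector_space (topspace X)"
    and "uniquely_extends X \<mu> E" "continuous_map X E f"
  shows "continuous_map \<mu> E (lin_ext f)"
proof -
  obtain g where g: "linear_between (topspace \<mu>) (topspace E) g"
      "continuous_map \<mu> E g" "\<forall>x\<in>topspace X. g (gen x) = f x"
    using assms(2,3) unfolding uniquely_extends_def by blast
  show ?thesis
    using g(2)
  proof (rule continuous_map_eq)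
    fix p assume "p \<in> topspace \<mu>"
    then show "g p = lin_ext f p"
      using linear_between_eq_lin_ext[of "topspace X" "topspace E" g p f] g assms(1) by simp
  qed
qed

lemma tvs_pullback:
  assumes "tvs E" "subspace S" "linear_between S (topspace E) g"
  shows "tvs (pullback_topology S g E)" "topspace (pullback_topology S g E) = S"
proof -
  let ?P = "pullback_topology S g E"
  show top: "topspace ?P = S"
    using assms(3) by (auto simp: topspace_pullback_topology linear_between_def)
  have g: "continuous_map ?P E g"
    using continuous_map_pullback[OF continuous_map_id, of S g E] by simp
  have "continuous_map (prod_topology ?P ?P) E (\<lambda>z. (\<lambda>(u, v). u + v) (g (fst z), g (snd z)))"
  proof (rule continuous_map_compose[of _ "prod_topology E E", unfolded o_def])
    show "continuous_map (prod_topology ?P ?P) (prod_topology E E) (\<lambda>z. (g (fst z), g (snd z)))"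
      using continuous_map_compose[OF continuous_map_fst g, of ?P]
        continuous_map_compose[OF continuous_map_snd g, of ?P]
      by (intro continuous_map_pairedI) (simp_all add: o_def)
  qed (use assms(1) in \<open>simp add: tvs_def\<close>)
  then have "continuous_map (prod_topology ?P ?P) E (\<lambda>z. g (fst z + snd z))"
    by (rule continuous_map_eq) (use assms(3) in \<open>auto simp: top linear_between_def\<close>)
  then have add: "continuous_map (prod_topology ?P ?P) ?P (\<lambda>(u, v). u + v)"
    by (intro continuous_map_pullback')
      (auto simp: o_def case_prod_unfold top subspace_add[OF assms(2)])
  have "continuous_map (prod_topology euclideanreal ?P) E
          (\<lambda>z. (\<lambda>(c, v). c *\<^sub>R v) (fst z, g (snd z)))"
  proof (rule continuous_map_compose[of _ "prod_topology euclideanreal E", unfolded o_def])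
    show "continuous_map (prod_topology euclideanreal ?P) (prod_topology euclideanreal E)
            (\<lambda>z. (fst z, g (snd z)))"
      using continuous_map_compose[OF continuous_map_snd g, of euclideanreal]
      by (intro continuous_map_pairedI continuous_map_fst) (simp_all add: o_def)
  qed (use assms(1) in \<open>simp add: tvs_def\<close>)
  then have "continuous_map (prod_topology euclideanreal ?P) E (\<lambda>z. g (fst z *\<^sub>R snd z))"
    by (rule continuous_map_eq) (use assms(3) in \<open>auto simp: top linear_between_def\<close>)
  then have scale: "continuous_map (prod_topology euclideanreal ?P) ?P (\<lambda>(c, v). c *\<^sub>R v)"
    by (intro continuous_map_pullback')
      (auto simp: o_def case_prod_unfold top subspace_scale[OF assms(2)])
  show "tvs ?P"
    using add scale assms(2) by (simp add: tvs_def top)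
qed

lemma lcs_pullback:
  assumes "lcs E" "subspace S" "linear_between S (topspace E) g"
  shows "lcs (pullback_topology S g E)"
proof -
  let ?P = "pullback_topology S g E"
  have E: "tvs E" "neighbourhood_base_at 0 convex E" using assms(1) by (auto simp: lcs_def)
  have g0: "g 0 = 0"
    using linear_between_sum[OF assms(3,2), of "{}"] by simp
  have zero: "0 \<in> S" using assms(2) by (rule subspace_0)
  have "neighbourhood_base_at 0 convex ?P"
    unfolding neighbourhood_base_at_def
  proof (intro allI impI)
    fix W assume W: "openin ?P W \<and> 0 \<in> W"
    then obtain U where U: "openin E U" "W = g -` U \<inter> S"
      by (auto simp: openin_pullback_topology)
    then have "0 \<in> U" using W g0 by auto
    then obtain A C where AC: "openin E A" "convex C" "0 \<in> A" "A \<subseteq> C" "C \<subseteq> U"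
      using E(2) U(1) unfolding neighbourhood_base_at_def by meson
    have "convex (g -` C \<inter> S)"
    proof (rule convexI)
      fix x y :: 'b and u v :: real
      assume h: "x \<in> g -` C \<inter> S" "y \<in> g -` C \<inter> S" "0 \<le> u" "0 \<le> v" "u + v = 1"
      have "u *\<^sub>R x \<in> S" "v *\<^sub>R y \<in> S" using h assms(2) by (auto intro: subspace_scale)
      moreover have "g (u *\<^sub>R x + v *\<^sub>R y) = u *\<^sub>R g x + v *\<^sub>R g y"
        using h assms(3) \<open>u *\<^sub>R x \<in> S\<close> \<open>v *\<^sub>R y \<in> S\<close> by (simp add: linear_between_def)
      moreover have "u *\<^sub>R g x + v *\<^sub>R g y \<in> C"
        using h AC(2) by (auto intro: convexD)
      ultimately show "u *\<^sub>R x + v *\<^sub>R y \<in> g -` C \<inter> S"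
        using assms(2) by (auto intro: subspace_add)
    qed
    moreover have "openin ?P (g -` A \<inter> S)" using AC(1) openin_pullback_topology by blast
    ultimately show "\<exists>U V. openin ?P U \<and> convex V \<and> 0 \<in> U \<and> U \<subseteq> V \<and> V \<subseteq> W"
      using AC g0 zero U(2) by (intro exI[of _ "g -` A \<inter> S"] exI[of _ "g -` C \<inter> S"]) auto
  qed
  then show ?thesis using tvs_pullback(1)[OF E(1) assms(2,3)] by (simp add: lcs_def)
qed

lemma linear_between_lin_ext:
  assumes "subspace T" "f ` S \<subseteq> T"
  shows "linear_between (free_vector_space S) T (lin_ext f)"
  using lin_ext_in[OF assms] by (auto simp: linear_between_def lin_ext_add lin_ext_scaleR)

lemma continuous_map_gen_pullback:
  assumes "continuous_map X E f"
  shows "continuous_map X (pullback_topology (free_vector_space (topspace X)) (lin_ext f) E) gen"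
  using assms
  by (intro continuous_map_pullback') (auto simp: o_def gen_in_free_vector_space)

lemma lin_ext_continuous_if_gen_pullback:
  assumes "continuous_map \<mu> (pullback_topology S (lin_ext f) E) id"
  shows "continuous_map \<mu> E (lin_ext f)"
  using continuous_map_compose[OF assms continuous_map_pullback[OF continuous_map_id]]
  by (simp add: o_def)

lemma lin_ext_gen_id: "lin_ext gen = id"
  by (rule ext) (simp add: lin_ext_gen_eq)

theorem free_tvs_universal_aux:
  fixes E :: "'e::real_vector topology"
  assumes "free_over tvs X \<mu>" "tvs E"
  shows "uniquely_extends X \<mu> E"
proof (rule uniquely_extendsI)
  show top: "topspace \<mu> = free_vector_space (topspace X)" using assms(1) by (simp add: free_over_def)
  show subE: "subspace (topspace E)" using assms(2) by (simp add: tvs_def)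
  fix f assume f: "continuous_map X E f"
  let ?P = "pullback_topology (free_vector_space (topspace X)) (lin_ext f) E"
  have "tvs ?P"
    using tvs_pullback[OF assms(2) subspace_free_vector_space linear_between_lin_ext[OF subE]]
      continuous_map_image_subset_topspace[OF f] by blast
  then have "uniquely_extends X \<mu> ?P" using assms(1) by (simp add: free_over_def)
  from uniquely_extendsD[OF top this continuous_map_gen_pullback[OF f]]
  show "continuous_map \<mu> E (lin_ext f)"
    by (intro lin_ext_continuous_if_gen_pullback) (simp add: lin_ext_gen_id)
qed

theorem free_lcs_universal_aux:
  fixes E :: "'e::real_vector topology"
  assumes "free_over lcs X \<mu>" "lcs E"
  shows "uniquely_extends X \<mu> E"
proof (rule uniquely_extendsI)
  show top: "topspace \<mu> = free_vector_space (topspace X)" using assms(1) by (simp add: free_over_def)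
  show subE: "subspace (topspace E)" using assms(2) by (simp add: lcs_def tvs_def)
  fix f assume f: "continuous_map X E f"
  let ?P = "pullback_topology (free_vector_space (topspace X)) (lin_ext f) E"
  have "lcs ?P"
    using lcs_pullback[OF assms(2) subspace_free_vector_space linear_between_lin_ext[OF subE]]
      continuous_map_image_subset_topspace[OF f] by blast
  then have "uniquely_extends X \<mu> ?P" using assms(1) by (simp add: free_over_def)
  from uniquely_extendsD[OF top this continuous_map_gen_pullback[OF f]]
  show "continuous_map \<mu> E (lin_ext f)"
    by (intro lin_ext_continuous_if_gen_pullback) (simp add: lin_ext_gen_id)
qed

definition admissible ::
    "(('a \<Rightarrow>\<^sub>0 real) topology \<Rightarrow> bool) \<Rightarrow> 'a topology \<Rightarrow> ('a \<Rightarrow>\<^sub>0 real) topology set" where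
  "admissible C X = {\<tau>. C \<tau> \<and> topspace \<tau> = free_vector_space (topspace X) \<and> continuous_map X \<tau> gen}"

definition sup_admissible ::
    "(('a \<Rightarrow>\<^sub>0 real) topology \<Rightarrow> bool) \<Rightarrow> 'a topology \<Rightarrow> ('a \<Rightarrow>\<^sub>0 real) topology" where
  "sup_admissible C X = topology_generated_by {U. \<exists>\<tau>\<in>admissible C X. openin \<tau> U}"

lemma lcs_euclideanreal: "lcs (euclideanreal)"
proof -
  have "continuous_on UNIV (\<lambda>(u::real, v). u + v)" "continuous_on UNIV (\<lambda>(c, u::real). c *\<^sub>R u)"
    by (auto simp: case_prod_unfold intro!: continuous_intros)
  then have "tvs euclideanreal"
    by (simp add: tvs_def prod_topology_euclidean)
  moreover have "neighbourhood_base_at (0::real) convex euclidean"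
    unfolding neighbourhood_base_at_def
  proof (intro allI impI)
    fix W assume "openin euclidean W \<and> (0::real) \<in> W"
    then obtain e where "e > 0" "ball 0 e \<subseteq> W" by (auto simp: open_contains_ball)
    then show "\<exists>U V. openin euclidean U \<and> convex V \<and> 0 \<in> U \<and> U \<subseteq> V \<and> V \<subseteq> W"
      by (intro exI[of _ "ball 0 e"]) auto
  qed
  ultimately show ?thesis by (simp add: lcs_def)
qed

lemma admissible_lcs_nonempty: "admissible lcs X \<noteq> {}"
proof -
  let ?P = "pullback_topology (free_vector_space (topspace X)) (lin_ext (\<lambda>_. 0 :: real)) euclideanreal"
  have lin: "linear_between (free_vector_space (topspace X)) (topspace euclideanreal)
      (lin_ext (\<lambda>_. 0 :: real))"
    by (rule linear_between_lin_ext) auto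
  have "lcs ?P" "topspace ?P = free_vector_space (topspace X)"
    using lcs_pullback[OF lcs_euclideanreal subspace_free_vector_space lin]
      tvs_pullback(2)[OF _ subspace_free_vector_space lin] lcs_euclideanreal
    by (auto simp: lcs_def)
  moreover have "continuous_map X ?P gen"
    by (rule continuous_map_gen_pullback) simp
  ultimately have "?P \<in> admissible lcs X" by (simp add: admissible_def)
  then show ?thesis by blast
qed

lemma admissible_tvs_nonempty: "admissible tvs X \<noteq> {}"
  using admissible_lcs_nonempty[of X] by (auto simp: admissible_def lcs_def)

lemma topspace_sup_admissible:
  assumes "admissible C X \<noteq> {}"
  shows "topspace (sup_admissible C X) = free_vector_space (topspace X)"
proof -
  obtain \<tau> where \<tau>: "\<tau> \<in> admissible C X" using assms by blast
  have top: "topspace \<sigma> = free_vector_space (topspace X)" if "\<sigma> \<in> admissible C X" for \<sigma>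
    using that by (simp add: admissible_def)
  have "\<Union> {U. \<exists>\<tau>\<in>admissible C X. openin \<tau> U} = free_vector_space (topspace X)"
  proof (rule antisym)
    show "\<Union> {U. \<exists>\<tau>\<in>admissible C X. openin \<tau> U} \<subseteq> free_vector_space (topspace X)"
      by (rule Union_least) (auto dest!: openin_subset simp: top)
    have "openin \<tau> (free_vector_space (topspace X))"
      using openin_topspace[of \<tau>] unfolding top[OF \<tau>] .
    then show "free_vector_space (topspace X) \<subseteq> \<Union> {U. \<exists>\<tau>\<in>admissible C X. openin \<tau> U}"
      using \<tau> by (intro Union_upper) blast
  qed
  then show ?thesis unfolding sup_admissible_def topology_generated_by_topspace .
qed

lemma continuous_map_into_sup_admissible:
  assumes "admissible C X \<noteq> {}" "\<And>\<tau>. \<tau> \<in> admissible C X \<Longrightarrow> continuous_map Y \<tau> h"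
  shows "continuous_map Y (sup_admissible C X) h"
  unfolding sup_admissible_def
proof (rule continuous_on_generated_topo)
  fix U assume "U \<in> {U. \<exists>\<tau>\<in>admissible C X. openin \<tau> U}"
  then obtain \<tau> where "\<tau> \<in> admissible C X" "openin \<tau> U" by blast
  then have "openin Y {x \<in> topspace Y. h x \<in> U}"
    using openin_continuous_map_preimage[OF assms(2)] by simp
  also have "{x \<in> topspace Y. h x \<in> U} = h -` U \<inter> topspace Y" by auto
  finally show "openin Y (h -` U \<inter> topspace Y)" .
next
  obtain \<tau> where \<tau>: "\<tau> \<in> admissible C X" using assms(1) by blast
  have "h ` topspace Y \<subseteq> topspace \<tau>"
    by (rule continuous_map_image_subset_topspace[OF assms(2)[OF \<tau>]])
  moreover have "topspace \<tau> \<subseteq> \<Union> {U. \<exists>\<tau>\<in>admissible C X. openin \<tau> U}"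
    using \<tau> openin_topspace[of \<tau>] by (intro Union_upper) blast
  ultimately show "h ` topspace Y \<subseteq> \<Union> {U. \<exists>\<tau>\<in>admissible C X. openin \<tau> U}"
    by (rule order_trans)
qed

lemma sup_admissible_finer:
  assumes "\<tau> \<in> admissible C X"
  shows "continuous_map (sup_admissible C X) \<tau> id"
proof -
  have "admissible C X \<noteq> {}" using assms by blast
  then have "topspace (sup_admissible C X) = topspace \<tau>"
    using topspace_sup_admissible assms by (auto simp: admissible_def)
  then show ?thesis
    using assms
    by (auto simp: continuous_map_openin_preimage_eq sup_admissible_def inf.absorb2 openin_subset
        intro!: topology_generated_by_Basis)
qed

lemma tvs_sup_admissible:
  assumes "admissible C X \<noteq> {}" "\<And>\<tau>. C \<tau> \<Longrightarrow> tvs \<tau>"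
  shows "tvs (sup_admissible C X)"
proof -
  let ?M = "sup_admissible C X"
  have "continuous_map (prod_topology ?M ?M) ?M (\<lambda>(u, v). u + v)"
  proof (rule continuous_map_into_sup_admissible[OF assms(1)])
    fix \<tau> assume t: "\<tau> \<in> admissible C X"
    have "continuous_map (prod_topology ?M ?M) (prod_topology \<tau> \<tau>) (\<lambda>(u, v). (id u, id v))"
      using sup_admissible_finer[OF t] by (subst continuous_map_prod_top) simp
    moreover have "continuous_map (prod_topology \<tau> \<tau>) \<tau> (\<lambda>(u, v). u + v)"
      using t assms(2) by (auto simp: admissible_def tvs_def)
    ultimately show "continuous_map (prod_topology ?M ?M) \<tau> (\<lambda>(u, v). u + v)"
      using continuous_map_compose by (fastforce simp: o_def case_prod_unfold)
  qed
  moreover have "continuous_map (prod_topology euclideanreal ?M) ?M (\<lambda>(c, u). c *\<^sub>R u)"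
  proof (rule continuous_map_into_sup_admissible[OF assms(1)])
    fix \<tau> assume t: "\<tau> \<in> admissible C X"
    have "continuous_map (prod_topology euclideanreal ?M) (prod_topology euclideanreal \<tau>)
            (\<lambda>(u, v). (id u, id v))"
      using sup_admissible_finer[OF t] by (subst continuous_map_prod_top) simp
    moreover have "continuous_map (prod_topology euclideanreal \<tau>) \<tau> (\<lambda>(c, u). c *\<^sub>R u)"
      using t assms(2) by (auto simp: admissible_def tvs_def)
    ultimately show "continuous_map (prod_topology euclideanreal ?M) \<tau> (\<lambda>(c, u). c *\<^sub>R u)"
      using continuous_map_compose by (fastforce simp: o_def case_prod_unfold)
  qed
  ultimately show ?thesis
    using topspace_sup_admissible[OF assms(1)] by (simp add: tvs_def subspace_free_vector_space)
qed

lemma lcs_sup_admissible: "lcs (sup_admissible lcs X)"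
proof -
  let ?M = "sup_admissible lcs X"
  let ?S = "{U. \<exists>\<tau>\<in>admissible lcs X. openin \<tau> U}"
  have key: "0 \<in> W \<longrightarrow> (\<exists>U V. openin ?M U \<and> convex V \<and> 0 \<in> U \<and> U \<subseteq> V \<and> V \<subseteq> W)"
    if "generate_topology_on ?S W" for W
    using that
  proof (induction rule: generate_topology_on.induct)
    case Empty
    then show ?case by simp
  next
    case (Int a b)
    show ?case
    proof
      assume "0 \<in> a \<inter> b"
      then obtain U V U' V' where "openin ?M U" "convex V" "0 \<in> U" "U \<subseteq> V" "V \<subseteq> a"
        "openin ?M U'" "convex V'" "0 \<in> U'" "U' \<subseteq> V'" "V' \<subseteq> b"
        using Int.IH by (metis IntD1 IntD2)
      then show "\<exists>U V. openin ?M U \<and> convex V \<and> 0 \<in> U \<and> U \<subseteq> V \<and> V \<subseteq> a \<inter> b"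
        by (intro exI[of _ "U \<inter> U'"] exI[of _ "V \<inter> V'"]) (auto intro: convex_Int)
    qed
  next
    case (UN K)
    then show ?case by (meson Union_iff Union_upper order_trans)
  next
    case (Basis W)
    show ?case
    proof
      assume "0 \<in> W"
      obtain \<tau> where t: "\<tau> \<in> admissible lcs X" "openin \<tau> W" using Basis by blast
      then have "neighbourhood_base_at 0 convex \<tau>" by (simp add: admissible_def lcs_def)
      then obtain U V where UV: "openin \<tau> U" "convex V" "0 \<in> U" "U \<subseteq> V" "V \<subseteq> W"
        using t(2) \<open>0 \<in> W\<close> unfolding neighbourhood_base_at_def by meson
      have "openin ?M U"
        unfolding sup_admissible_def by (rule topology_generated_by_Basis) (use t UV in auto)
      then show "\<exists>U V. openin ?M U \<and> convex V \<and> 0 \<in> U \<and> U \<subseteq> V \<and> V \<subseteq> W" using UV by blast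
    qed
  qed
  have "neighbourhood_base_at 0 convex ?M"
    unfolding neighbourhood_base_at_def
    using key openin_topology_generated_by unfolding sup_admissible_def by blast
  moreover have "tvs ?M"
    by (rule tvs_sup_admissible[OF admissible_lcs_nonempty]) (simp add: lcs_def)
  ultimately show ?thesis by (simp add: lcs_def)
qed

lemma free_over_sup_admissible:
  assumes "admissible C X \<noteq> {}" "C (sup_admissible C X)"
    and sub: "\<And>E. C E \<Longrightarrow> subspace (topspace E)"
    and pull: "\<And>E f. C E \<Longrightarrow> continuous_map X E f \<Longrightarrow>
        pullback_topology (free_vector_space (topspace X)) (lin_ext f) E \<in> admissible C X"
  shows "free_over C X (sup_admissible C X)"
proof -
  have top: "topspace (sup_admissible C X) = free_vector_space (topspace X)"
    by (rule topspace_sup_admissible[OF assms(1)])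
  have "continuous_map X (sup_admissible C X) gen"
    by (rule continuous_map_into_sup_admissible[OF assms(1)]) (simp add: admissible_def)
  moreover have "uniquely_extends X (sup_admissible C X) E" if "C E" for E
    using sub[OF that] lin_ext_continuous_if_gen_pullback sup_admissible_finer[OF pull[OF that]]
    by (intro uniquely_extendsI[OF top]) blast+
  ultimately show ?thesis using assms(2) top by (simp add: free_over_def)
qed

lemma free_over_unique:
  assumes "free_over C X \<mu>" "free_over C X \<nu>"
  shows "\<mu> = \<nu>"
proof -
  have *: "openin \<mu> U" if "free_over C X \<mu>" "free_over C X \<nu>" "openin \<nu> U" for \<mu> \<nu> U
  proof -
    have top: "topspace \<mu> = topspace \<nu>" "topspace \<mu> = free_vector_space (topspace X)"
      using that by (auto simp: free_over_def)
    have "continuous_map \<mu> \<nu> (lin_ext gen)"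
      using that by (intro uniquely_extendsD[OF top(2)]) (auto simp: free_over_def)
    then have "openin \<mu> {x \<in> topspace \<mu>. id x \<in> U}"
      unfolding lin_ext_gen_id using that(3) openin_continuous_map_preimage by blast
    moreover have "{x \<in> topspace \<mu>. id x \<in> U} = U" using that(3) top openin_subset by fastforce
    ultimately show ?thesis by simp
  qed
  show ?thesis using *[OF assms] *[OF assms(2,1)] by (auto simp: topology_eq)
qed

theorem free_over_free_tvs: "free_over tvs X (free_tvs X)"
proof -
  have "free_over tvs X (sup_admissible tvs X)"
  proof (rule free_over_sup_admissible)
    fix E :: "('a \<Rightarrow>\<^sub>0 real) topology" and f
    assume E: "tvs E" and f: "continuous_map X E f"
    then have lin: "linear_between (free_vector_space (topspace X)) (topspace E) (lin_ext f)"
      using continuous_map_image_subset_topspace[OF f]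
      by (intro linear_between_lin_ext) (auto simp: tvs_def)
    show "pullback_topology (free_vector_space (topspace X)) (lin_ext f) E \<in> admissible tvs X"
      using tvs_pullback[OF E subspace_free_vector_space lin] continuous_map_gen_pullback[OF f]
      by (simp add: admissible_def)
  next
    show "tvs (sup_admissible tvs X)"
      by (rule tvs_sup_admissible[OF admissible_tvs_nonempty])
  qed (simp_all add: tvs_def admissible_tvs_nonempty)
  then show ?thesis
    unfolding free_tvs_def by (rule theI) (use \<open>free_over tvs X _\<close> free_over_unique in blast)
qed

theorem free_over_free_lcs: "free_over lcs X (free_lcs X)"
proof -
  have "free_over lcs X (sup_admissible lcs X)"
  proof (rule free_over_sup_admissible)
    fix E :: "('a \<Rightarrow>\<^sub>0 real) topology" and f
    assume E: "lcs E" and f: "continuous_map X E f"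
    then have lin: "linear_between (free_vector_space (topspace X)) (topspace E) (lin_ext f)"
      using continuous_map_image_subset_topspace[OF f]
      by (intro linear_between_lin_ext) (auto simp: lcs_def tvs_def)
    have "tvs E" using E by (simp add: lcs_def)
    then show "pullback_topology (free_vector_space (topspace X)) (lin_ext f) E \<in> admissible lcs X"
      using lcs_pullback[OF E subspace_free_vector_space lin] continuous_map_gen_pullback[OF f]
        tvs_pullback(2)[OF _ subspace_free_vector_space lin]
      by (simp add: admissible_def)
  next
    show "lcs (sup_admissible lcs X)"
      by (rule lcs_sup_admissible)
  qed (simp_all add: lcs_def tvs_def admissible_lcs_nonempty)
  then show ?thesis
    unfolding free_lcs_def by (rule theI) (use \<open>free_over lcs X _\<close> free_over_unique in blast)
qed

theorem free_tvs_universal: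
  fixes E :: "'e::real_vector topology"
  assumes "tvs E"
  shows "uniquely_extends X (free_tvs X) E"
  using free_tvs_universal_aux[OF free_over_free_tvs assms] .

theorem free_lcs_universal:
  fixes E :: "'e::real_vector topology"
  assumes "lcs E"
  shows "uniquely_extends X (free_lcs X) E"
  using free_lcs_universal_aux[OF free_over_free_lcs assms] .

end

theory Submission
  imports Defs
begin

text \<open>
  The topology of a free space is the finest one, among the vector topologies of the class under
  consideration, that makes the inclusion of \<open>X\<close> continuous. A family of sets is therefore a
  neighbourhood base at zero as soon as two things hold: it is a base at zero of \<^emph>\<open>some\<close> such
  topology, so that its members are neighbourhoods of zero in the finest one
  (\<open>nhood_base_free_over\<close>), and it is fine enough to get below every neighbourhood of zero in
  every vector topology that makes the inclusion continuous.

  For the first point, a directed family of balanced absorbing sets in which every member contains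
  \<open>C + C\<close> for another member \<open>C\<close> is a base at zero of a vector topology (locale
  \<open>zero_base\<close>). The sums in question have these properties
  (\<open>zero_base_base_family\<close>): two sums over a sequence \<open>W\<close> merge into one sum over
  \<open>V\<close> by interleaving their terms when \<open>W n\<close> is small with respect to both
  \<open>V (2 n - 1)\<close> and \<open>V (2 n)\<close>; the multiples of the generators make the sums absorbing.
  The inclusion is continuous because \<open>y - x\<close> lies in the sum whenever \<open>(x, y)\<close> lies in
  \<open>V 1\<close>. All this passes to convex hulls, because taking convex hulls commutes with addition
  and scaling.

  For the second point (\<open>base_family_inside\<close>), take neighbourhoods \<open>U n\<close> of zero with
  \<open>U (n + 1) + U (n + 1)\<close> inside \<open>U n\<close>. A sum of terms \<open>a n\<close> taken from
  \<open>U (k + n)\<close>, for positive \<open>n\<close>, stays in \<open>U k\<close>. So it suffices that the terms of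
  index \<open>n\<close> are in the right \<open>U j\<close>. For the differences this is a condition on pairs
  \<open>(x, y)\<close>, which defines a member of the universal uniformity (\<open>difference_entourage\<close>);
  for the multiples \<open>t x\<close> it holds when \<open>t\<close> is small, depending on \<open>x\<close>. In the
  locally convex case, a convex neighbourhood that contains a sum contains its convex hull.

  If \<open>X\<close> is pseudocompact, it is totally bounded in its universal uniformity
  (\<open>pseudocompact_totally_bounded\<close>), for otherwise bump functions of growing height around the
  points of a uniformly discrete sequence would add up to an unbounded continuous function. Hence
  every point of \<open>X\<close> differs by a small vector from one of finitely many points, and one bound
  on \<open>t\<close> serves for all \<open>x\<close> (\<open>uniform_multiples_inside\<close>).

  Membership in the universal uniformity is handled through an explicit description
  (\<open>universal_uniformity_eq\<close>): its members are the sets that contain the first term of a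
  normal sequence.
\<close>

section \<open>The universal uniformity of a completely regular space\<close>

definition sectionwise_nhood :: "'a topology \<Rightarrow> ('a \<times> 'a) set \<Rightarrow> bool" where
  "sectionwise_nhood X W \<longleftrightarrow>
     W \<subseteq> topspace X \<times> topspace X \<and>
     (\<forall>x\<in>topspace X. \<exists>N. openin X N \<and> x \<in> N \<and> N \<subseteq> W `` {x})"

text \<open>A sequence of this kind is what the metrization lemma for uniformities turns into a continuous
  pseudometric. Only the neighbourhoods \<open>W n `` {x}\<close> of points are tied to the topology, so
  that the notion makes sense before any uniformity is known to be compatible.\<close>

definition normal_sequence :: "'a topology \<Rightarrow> (nat \<Rightarrow> ('a \<times> 'a) set) \<Rightarrow> bool" where
  "normal_sequence X W \<longleftrightarrow>
     (\<forall>n. sectionwise_nhood X (W n) \<and> sym (W n) \<and> W (Suc n) O W (Suc n) \<subseteq> W n)"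

definition normal_entourages :: "'a topology \<Rightarrow> ('a \<times> 'a) set set" where
  "normal_entourages X =
     {V. V \<subseteq> topspace X \<times> topspace X \<and> (\<exists>W. normal_sequence X W \<and> W 0 \<subseteq> V)}"

lemma sectionwise_nhood_Int:
  assumes "sectionwise_nhood X V" "sectionwise_nhood X W"
  shows "sectionwise_nhood X (V \<inter> W)"
  unfolding sectionwise_nhood_def
proof (intro conjI ballI)
  fix x assume "x \<in> topspace X"
  then obtain M N where "openin X M" "x \<in> M" "M \<subseteq> V `` {x}" "openin X N" "x \<in> N" "N \<subseteq> W `` {x}"
    using assms unfolding sectionwise_nhood_def by meson
  then show "\<exists>N. openin X N \<and> x \<in> N \<and> N \<subseteq> (V \<inter> W) `` {x}"
    by (intro exI[of _ "M \<inter> N"]) auto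
qed (use assms in \<open>auto simp: sectionwise_nhood_def\<close>)

lemma sectionwise_nhood_Id_on: "sectionwise_nhood X W \<Longrightarrow> Id_on (topspace X) \<subseteq> W"
  unfolding sectionwise_nhood_def by blast

lemma normal_sequence_member:
  assumes "normal_sequence X W"
  shows "W n \<in> normal_entourages X"
  unfolding normal_entourages_def
proof (intro CollectI conjI exI[of _ "\<lambda>k. W (n + k)"])
  show "W n \<subseteq> topspace X \<times> topspace X"
    using assms by (simp add: normal_sequence_def sectionwise_nhood_def)
qed (use assms in \<open>auto simp: normal_sequence_def\<close>)

lemma uniformity_of_set_normal_entourages: "uniformity_of_set (topspace X) (normal_entourages X)"
  unfolding uniformity_of_set_def
proof (intro conjI ballI allI impI)
  let ?S = "topspace X"
  have "normal_sequence X (\<lambda>n. ?S \<times> ?S)"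
    by (auto simp: normal_sequence_def sectionwise_nhood_def sym_def)
  then show "normal_entourages X \<noteq> {}"
    using normal_sequence_member by blast
  show "Id_on ?S \<subseteq> V" "V \<subseteq> ?S \<times> ?S" if V: "V \<in> normal_entourages X" for V
  proof -
    obtain A where A: "normal_sequence X A" "A 0 \<subseteq> V"
      using V by (auto simp: normal_entourages_def)
    then have "Id_on ?S \<subseteq> A 0"
      by (simp add: normal_sequence_def sectionwise_nhood_Id_on)
    then show "Id_on ?S \<subseteq> V"
      using A(2) by blast
    show "V \<subseteq> ?S \<times> ?S"
      using V by (simp add: normal_entourages_def)
  qed
  show "W \<in> normal_entourages X"
    if "V \<in> normal_entourages X" "V \<subseteq> W \<and> W \<subseteq> ?S \<times> ?S" for V W
    using that unfolding normal_entourages_def by blast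
  show "V \<inter> W \<in> normal_entourages X"
    if V: "V \<in> normal_entourages X" and W: "W \<in> normal_entourages X" for V W
  proof -
    obtain A where A: "normal_sequence X A" "A 0 \<subseteq> V"
      using V by (auto simp: normal_entourages_def)
    obtain B where B: "normal_sequence X B" "B 0 \<subseteq> W"
      using W by (auto simp: normal_entourages_def)
    have "normal_sequence X (\<lambda>n. A n \<inter> B n)"
      unfolding normal_sequence_def
    proof (intro allI conjI)
      fix n
      show "sectionwise_nhood X (A n \<inter> B n)" "sym (A n \<inter> B n)"
        using A(1) B(1) by (simp_all add: normal_sequence_def sectionwise_nhood_Int sym_Int)
      have "A (Suc n) O A (Suc n) \<subseteq> A n" "B (Suc n) O B (Suc n) \<subseteq> B n"
        using A(1) B(1) by (simp_all add: normal_sequence_def)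
      then show "(A (Suc n) \<inter> B (Suc n)) O (A (Suc n) \<inter> B (Suc n)) \<subseteq> A n \<inter> B n"
        by blast
    qed
    moreover have "A 0 \<inter> B 0 \<subseteq> V \<inter> W" "V \<inter> W \<subseteq> ?S \<times> ?S"
      using A(2) B(2) V W by (auto simp: normal_entourages_def)
    ultimately show ?thesis
      unfolding normal_entourages_def by blast
  qed
  show "V\<inverse> \<in> normal_entourages X" if V: "V \<in> normal_entourages X" for V
  proof -
    obtain A where A: "normal_sequence X A" "A 0 \<subseteq> V"
      using V by (auto simp: normal_entourages_def)
    then have "A 0 \<subseteq> V\<inverse>"
      by (auto simp: normal_sequence_def dest: symD)
    then show ?thesis
      using A(1) V by (auto simp: normal_entourages_def)
  qed
  show "\<exists>W\<in>normal_entourages X. W O W \<subseteq> V" if V: "V \<in> normal_entourages X" for V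
  proof -
    obtain A where A: "normal_sequence X A" "A 0 \<subseteq> V"
      using V by (auto simp: normal_entourages_def)
    then have "A (Suc 0) O A (Suc 0) \<subseteq> V"
      by (meson normal_sequence_def order_trans)
    then show ?thesis
      using normal_sequence_member[OF A(1)] by blast
  qed
qed

lemma openin_if_sections:
  assumes "U \<subseteq> topspace X" "\<And>x. x \<in> U \<Longrightarrow> \<exists>V\<in>normal_entourages X. V `` {x} \<subseteq> U"
  shows "openin X U"
proof (subst openin_subopen, intro ballI)
  fix x assume "x \<in> U"
  then obtain V where V: "V \<in> normal_entourages X" "V `` {x} \<subseteq> U"
    using assms(2) by meson
  then obtain W where W: "normal_sequence X W" "W 0 \<subseteq> V"
    by (auto simp: normal_entourages_def)
  then have "sectionwise_nhood X (W 0)"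
    by (simp add: normal_sequence_def)
  then obtain N where "openin X N" "x \<in> N" "N \<subseteq> W 0 `` {x}"
    using \<open>x \<in> U\<close> assms(1) unfolding sectionwise_nhood_def by blast
  then show "\<exists>N. openin X N \<and> x \<in> N \<and> N \<subseteq> U"
    using V(2) W(2) by blast
qed

text \<open>Halving the bound on the oscillation of \<open>f\<close> at each step gives a normal sequence, by the
  triangle inequality. The functions supplied by complete regularity thus yield entourages that
  separate points from closed sets.\<close>

lemma normal_entourage_of_function:
  fixes f :: "'a \<Rightarrow> real"
  assumes f: "continuous_map X euclideanreal f" and "e > 0"
  shows "{(x, y) \<in> topspace X \<times> topspace X. \<bar>f x - f y\<bar> < e} \<in> normal_entourages X"
proof -
  define W where "W n = {(x, y) \<in> topspace X \<times> topspace X. \<bar>f x - f y\<bar> < e / 2 ^ n}" for n :: nat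
  have "normal_sequence X W"
    unfolding normal_sequence_def
  proof (intro allI conjI)
    fix n
    show "sectionwise_nhood X (W n)"
      unfolding sectionwise_nhood_def
    proof (intro conjI ballI)
      fix x assume x: "x \<in> topspace X"
      let ?N = "{y \<in> topspace X. f y \<in> ball (f x) (e / 2 ^ n)}"
      have "openin X ?N"
        by (rule openin_continuous_map_preimage[OF f]) simp
      then show "\<exists>N. openin X N \<and> x \<in> N \<and> N \<subseteq> W n `` {x}"
        using x \<open>e > 0\<close> by (intro exI[of _ ?N]) (auto simp: W_def dist_real_def)
    qed (auto simp: W_def)
    show "sym (W n)"
      by (auto simp: W_def sym_def abs_minus_commute)
    show "W (Suc n) O W (Suc n) \<subseteq> W n"
    proof clarify
      fix x y z assume "(x, y) \<in> W (Suc n)" "(y, z) \<in> W (Suc n)"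
      then have "x \<in> topspace X" "z \<in> topspace X"
        "\<bar>f x - f y\<bar> < e / 2 ^ n / 2" "\<bar>f y - f z\<bar> < e / 2 ^ n / 2"
        by (auto simp: W_def mult.commute)
      then show "(x, z) \<in> W n"
        unfolding W_def by auto
    qed
  qed
  from normal_sequence_member[OF this, of 0] show ?thesis
    by (simp add: W_def)
qed

lemma compatible_normal_entourages:
  assumes "completely_regular_space X"
  shows "compatible_uniformity X (normal_entourages X)"
  unfolding compatible_uniformity_def
proof (intro conjI allI uniformity_of_set_normal_entourages iffI)
  fix U assume U: "openin X U"
  have "\<exists>V\<in>normal_entourages X. V `` {x} \<subseteq> U" if "x \<in> U" for x
  proof -
    have "closedin X (topspace X - U)" "x \<in> topspace X - (topspace X - U)"
      using U that openin_subset by auto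
    then obtain f where f: "continuous_map X (top_of_set {0..1::real}) f"
      "f x = 0" "f ` (topspace X - U) \<subseteq> {1}"
      using assms unfolding completely_regular_space_def by meson
    have "continuous_map X euclideanreal f"
      using f(1) continuous_map_in_subtopology by blast
    then have "{(x, y) \<in> topspace X \<times> topspace X. \<bar>f x - f y\<bar> < 1} \<in> normal_entourages X"
      by (rule normal_entourage_of_function) simp
    then show ?thesis
      by (rule bexI[rotated]) (use f(2,3) in \<open>fastforce\<close>)
  qed
  then show "U \<subseteq> topspace X" "\<forall>x\<in>U. \<exists>V\<in>normal_entourages X. V `` {x} \<subseteq> U"
    using openin_subset[OF U] by auto
next
  fix U assume "U \<subseteq> topspace X \<and> (\<forall>x\<in>U. \<exists>V\<in>normal_entourages X. V `` {x} \<subseteq> U)"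
  then show "openin X U"
    by (intro openin_if_sections) simp_all
qed

lemma
  assumes "uniformity_of_set S \<U>" "V \<in> \<U>"
  shows uniformity_of_set_half: "\<exists>W\<in>\<U>. W O W \<subseteq> V"
    and uniformity_of_set_between: "Id_on S \<subseteq> V \<and> V \<subseteq> S \<times> S"
    and uniformity_of_set_symmetrize: "V \<inter> V\<inverse> \<in> \<U>"
proof -
  note unif = assms(1)[unfolded uniformity_of_set_def]
  show "\<exists>W\<in>\<U>. W O W \<subseteq> V"
    using unif[THEN conjunct2, THEN conjunct2, THEN conjunct2, THEN conjunct2, THEN conjunct2] assms(2)
    by (rule bspec)
  show "Id_on S \<subseteq> V \<and> V \<subseteq> S \<times> S"
    using unif[THEN conjunct2, THEN conjunct1] assms(2) by (rule bspec)
  have "V\<inverse> \<in> \<U>"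
    using unif[THEN conjunct2, THEN conjunct2, THEN conjunct2, THEN conjunct2, THEN conjunct1] assms(2)
    by (rule bspec)
  with unif[THEN conjunct2, THEN conjunct2, THEN conjunct2, THEN conjunct1] assms(2)
  show "V \<inter> V\<inverse> \<in> \<U>" by blast
qed

lemma uniformity_of_set_Int:
  assumes "uniformity_of_set S \<U>" "V \<in> \<U>" "W \<in> \<U>"
  shows "V \<inter> W \<in> \<U>"
  using assms(1)[unfolded uniformity_of_set_def, THEN conjunct2, THEN conjunct2, THEN conjunct2,
      THEN conjunct1] assms(2,3) by blast

text \<open>The points whose section under some entourage stays inside \<open>V `` {x}\<close> form an open set,
  because entourages can be halved; it is the interior of \<open>V `` {x}\<close> and contains \<open>x\<close>.\<close>

lemma compatible_sectionwise_nhood: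
  assumes "compatible_uniformity X \<W>" "V \<in> \<W>"
  shows "sectionwise_nhood X V"
  unfolding sectionwise_nhood_def
proof (intro conjI ballI)
  note compat = assms(1)[unfolded compatible_uniformity_def]
  note unif = compat[THEN conjunct1]
    and op = compat[THEN conjunct2, THEN spec]
  show "V \<subseteq> topspace X \<times> topspace X"
    using uniformity_of_set_between[OF unif assms(2)] by blast
  fix x assume x: "x \<in> topspace X"
  let ?N = "{y \<in> topspace X. \<exists>W\<in>\<W>. W `` {y} \<subseteq> V `` {x}}"
  have "\<exists>W'\<in>\<W>. W' `` {y} \<subseteq> ?N" if y: "y \<in> ?N" for y
  proof -
    obtain W where W: "W \<in> \<W>" "W `` {y} \<subseteq> V `` {x}" using y by blast
    obtain W' where W': "W' \<in> \<W>" "W' O W' \<subseteq> W"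
      using uniformity_of_set_half[OF unif W(1)] by blast
    have "W' \<subseteq> topspace X \<times> topspace X"
      using uniformity_of_set_between[OF unif W'(1)] by blast
    moreover have "W' `` {z} \<subseteq> V `` {x}" if "(y, z) \<in> W'" for z
      using W(2) W'(2) that by blast
    ultimately have "W' `` {y} \<subseteq> ?N"
      using W'(1) by auto
    then show ?thesis using W'(1) by blast
  qed
  then have "openin X ?N" using op[of ?N] by simp
  moreover have "x \<in> ?N" using x assms(2) by blast
  moreover have "?N \<subseteq> V `` {x}"
  proof
    fix y assume "y \<in> ?N"
    then obtain W where "W \<in> \<W>" "W `` {y} \<subseteq> V `` {x}" "y \<in> topspace X" by blast
    moreover have "Id_on (topspace X) \<subseteq> W"
      using uniformity_of_set_between[OF unif calculation(1)] by blast
    ultimately show "y \<in> V `` {x}" by blast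
  qed
  ultimately show "\<exists>N. openin X N \<and> x \<in> N \<and> N \<subseteq> V `` {x}" by blast
qed

text \<open>Inside a compatible uniformity one can repeatedly pass to a symmetric half of an entourage, and
  the sequence obtained in this way is normal.\<close>

lemma compatible_subset_normal_entourages:
  assumes "compatible_uniformity X \<W>"
  shows "\<W> \<subseteq> normal_entourages X"
proof
  fix V assume V: "V \<in> \<W>"
  have unif: "uniformity_of_set (topspace X) \<W>"
    using assms unfolding compatible_uniformity_def by (rule conjunct1)
  have symm: "\<exists>W\<in>\<W>. sym W \<and> W \<subseteq> V" if "V \<in> \<W>" for V
  proof (intro bexI conjI)
    show "V \<inter> V\<inverse> \<in> \<W>"
      by (rule uniformity_of_set_symmetrize[OF unif that])
  qed (auto simp: sym_def)
  have half: "\<exists>W\<in>\<W>. sym W \<and> W O W \<subseteq> V" if "V \<in> \<W>" for V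
  proof -
    obtain W where "W \<in> \<W>" "W O W \<subseteq> V"
      using uniformity_of_set_half[OF unif \<open>V \<in> \<W>\<close>] by blast
    moreover obtain W' where "W' \<in> \<W>" "sym W'" "W' \<subseteq> W"
      using symm[OF calculation(1)] by blast
    ultimately show ?thesis by (intro bexI[of _ W']) auto
  qed
  obtain A where A: "A \<in> \<W>" "sym A" "A \<subseteq> V" using symm[OF V] by blast
  obtain W where W: "\<forall>n. (W n \<in> \<W> \<and> sym (W n) \<and> (n = 0 \<longrightarrow> W n = A)) \<and> W (Suc n) O W (Suc n) \<subseteq> W n"
  proof (rule exE[OF dependent_nat_choice[where P = "\<lambda>n W. W \<in> \<W> \<and> sym W \<and> (n = 0 \<longrightarrow> W = A)"
          and Q = "\<lambda>n W W'. W' O W' \<subseteq> W"]])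
    show "\<exists>W. W \<in> \<W> \<and> sym W \<and> (0 = (0::nat) \<longrightarrow> W = A)"
      using A by auto
    show "\<exists>W'. (W' \<in> \<W> \<and> sym W' \<and> (Suc n = 0 \<longrightarrow> W' = A)) \<and> W' O W' \<subseteq> W"
      if "W \<in> \<W> \<and> sym W \<and> (n = 0 \<longrightarrow> W = A)" for W n
      using half[of W] that by auto
  qed
  then have "normal_sequence X W"
    using compatible_sectionwise_nhood[OF assms] by (simp add: normal_sequence_def)
  moreover have "W 0 \<subseteq> V"
    using W A(3) by simp
  moreover have "V \<subseteq> topspace X \<times> topspace X"
    using compatible_sectionwise_nhood[OF assms V] by (simp add: sectionwise_nhood_def)
  ultimately show "V \<in> normal_entourages X"
    unfolding normal_entourages_def by blast
qed

lemma universal_uniformity_eq: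
  assumes "completely_regular_space X"
  shows "universal_uniformity X = normal_entourages X"
  unfolding universal_uniformity_def
proof (rule the_equality)
  show "compatible_uniformity X (normal_entourages X) \<and>
      (\<forall>\<W>. compatible_uniformity X \<W> \<longrightarrow> \<W> \<subseteq> normal_entourages X)"
    using compatible_normal_entourages[OF assms] compatible_subset_normal_entourages by auto
  fix \<U> assume "compatible_uniformity X \<U> \<and>
      (\<forall>\<W>. compatible_uniformity X \<W> \<longrightarrow> \<W> \<subseteq> \<U>)"
  then show "\<U> = normal_entourages X"
    using compatible_normal_entourages[OF assms] compatible_subset_normal_entourages[of X \<U>] by auto
qed

section \<open>Pseudocompact spaces are totally bounded\<close>

text \<open>If no finite set suffices, there is a sequence of points no two of which are \<open>V\<close>-close. Let
  \<open>W\<close> be a symmetric fourth part of \<open>V\<close>, and choose bump functions \<open>f n\<close> that live in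
  the \<open>W\<close>-neighbourhoods of the points \<open>x n\<close>. At most one of
  them is not identically zero on a given set \<open>W `` {y}\<close>, so the sum of the functions
  \<open>n f n\<close> is continuous; it is unbounded, as its value at \<open>x n\<close> is \<open>n\<close>.\<close>

lemma pseudocompact_totally_bounded:
  assumes creg: "completely_regular_space X" and pc: "pseudocompact_space X"
    and V: "V \<in> normal_entourages X"
  shows "\<exists>F. finite F \<and> F \<subseteq> topspace X \<and> topspace X \<subseteq> V `` F"
proof (rule ccontr)
  assume neg: "\<not> ?thesis"
  obtain W' where W': "normal_sequence X W'" "W' 0 \<subseteq> V"
    using V by (auto simp: normal_entourages_def)
  define W where "W = W' (Suc (Suc 0))"
  have W: "sectionwise_nhood X W" "sym W"
    using W'(1) by (simp_all add: normal_sequence_def W_def)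
  have "W O W \<subseteq> W' (Suc 0)" "W' (Suc 0) O W' (Suc 0) \<subseteq> W' 0"
    using W'(1) unfolding W_def normal_sequence_def by blast+
  then have W4: "(W O W) O (W O W) \<subseteq> V"
    using W'(2) by (meson order_trans relcomp_mono)
  have "\<exists>x. \<forall>n::nat. x n \<in> topspace X \<and> (\<forall>i<n. (x i, x n) \<notin> V)"
  proof (rule dependent_wellorder_choice)
    fix n :: nat and f :: "nat \<Rightarrow> 'a"
    assume f: "\<And>i. i < n \<Longrightarrow> f i \<in> topspace X \<and> (\<forall>j<i. (f j, f i) \<notin> V)"
    have "finite (f ` {..<n}) \<and> f ` {..<n} \<subseteq> topspace X" using f by auto
    then have "\<not> topspace X \<subseteq> V `` (f ` {..<n})" using neg by blast
    then show "\<exists>r. r \<in> topspace X \<and> (\<forall>i<n. (f i, r) \<notin> V)" by blast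
  qed simp
  then obtain x where x: "\<And>n::nat. x n \<in> topspace X" "\<And>i n. i < n \<Longrightarrow> (x i, x n) \<notin> V"
    by blast
  have "\<exists>f. continuous_map X euclideanreal f \<and> f (x n) = 1 \<and> (\<forall>y\<in>topspace X. f y \<noteq> 0 \<longrightarrow> (x n, y) \<in> W)" for n
  proof -
    obtain N where N: "openin X N" "x n \<in> N" "N \<subseteq> W `` {x n}"
      using W(1) x(1)[of n] unfolding sectionwise_nhood_def by blast
    have "closedin X (topspace X - N)" "x n \<in> topspace X - (topspace X - N)"
      using N x(1) by auto
    then obtain f where f: "continuous_map X (top_of_set {0..1::real}) f"
      "f (x n) = 0" "f ` (topspace X - N) \<subseteq> {1}"
      using creg unfolding completely_regular_space_def by meson
    have "continuous_map X euclideanreal (\<lambda>y. 1 - f y)"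
      using f(1) by (intro continuous_intros) (auto simp: continuous_map_in_subtopology)
    moreover have "(x n, y) \<in> W" if "y \<in> topspace X" "1 - f y \<noteq> 0" for y
      using that f(3) N(3) by fastforce
    ultimately show ?thesis
      using f(2) by (intro exI[of _ "\<lambda>y. 1 - f y"]) auto
  qed
  then obtain f where f: "\<And>n. continuous_map X euclideanreal (f n)" "\<And>n. f n (x n) = 1"
    "\<And>n y. y \<in> topspace X \<Longrightarrow> f n y \<noteq> 0 \<Longrightarrow> (x n, y) \<in> W"
    by metis
  have near: "i = j" if h: "y \<in> topspace X" "(y, z) \<in> W" "(y, z') \<in> W"
    "f i z \<noteq> 0" "f j z' \<noteq> 0" for y z z' i j
  proof -
    have "z \<in> topspace X" "z' \<in> topspace X"
      using h W(1) unfolding sectionwise_nhood_def by blast+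
    then have "(x i, z) \<in> W" "(x j, z') \<in> W" using f(3) h by blast+
    then have "(x i, x j) \<in> (W O W) O (W O W)" "(x j, x i) \<in> (W O W) O (W O W)"
      using h(2,3) W(2) by (meson relcompI symD)+
    then have "(x i, x j) \<in> V" "(x j, x i) \<in> V" using W4 by blast+
    then show ?thesis using x(2) by (metis nat_neq_iff)
  qed
  \<comment> \<open>At each point at most one summand is nonzero, so the sum over this set is finite.\<close>
  define g where "g z = (\<Sum>i\<in>{i. f i z \<noteq> 0}. real i * f i z)" for z
  have locally: "\<exists>N i. openin X N \<and> y \<in> N \<and> (\<forall>z\<in>N. g z = real i * f i z)" if y: "y \<in> topspace X" for y
  proof -
    obtain N where N: "openin X N" "y \<in> N" "N \<subseteq> W `` {y}"
      using W(1) y unfolding sectionwise_nhood_def by blast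
    obtain i where i: "\<And>z j. z \<in> N \<Longrightarrow> f j z \<noteq> 0 \<Longrightarrow> j = i"
    proof (cases "\<exists>z\<in>N. \<exists>i. f i z \<noteq> 0")
      case True
      then obtain z i where "z \<in> N" "f i z \<noteq> 0" by blast
      then show thesis using that[of i] near[OF y] N(3) by blast
    qed blast
    have "g z = real i * f i z" if "z \<in> N" for z
    proof -
      have "g z = (\<Sum>j\<in>{i}. real j * f j z)"
        unfolding g_def by (rule sum.mono_neutral_left) (use i[OF that] in auto)
      then show ?thesis by simp
    qed
    then show ?thesis using N by blast
  qed
  have "continuous_map X euclideanreal g"
    unfolding continuous_map_def
  proof (intro conjI allI impI)
    fix U :: "real set" assume U: "openin euclideanreal U"
    show "openin X {y \<in> topspace X. g y \<in> U}"
    proof (subst openin_subopen, intro ballI)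
      fix y assume y: "y \<in> {y \<in> topspace X. g y \<in> U}"
      then obtain N i where N: "openin X N" "y \<in> N" "\<forall>z\<in>N. g z = real i * f i z"
        using locally by blast
      have "continuous_map X euclideanreal (\<lambda>z. real i * f i z)"
        using f(1) by (intro continuous_intros)
      then have "openin X (N \<inter> {z \<in> topspace X. real i * f i z \<in> U})"
        using U N(1) by (intro openin_Int openin_continuous_map_preimage)
      moreover have "N \<inter> {z \<in> topspace X. real i * f i z \<in> U} \<subseteq> {y \<in> topspace X. g y \<in> U}"
        using N(3) by auto
      moreover have "y \<in> N \<inter> {z \<in> topspace X. real i * f i z \<in> U}" using N y by auto
      ultimately show "\<exists>M. openin X M \<and> y \<in> M \<and> M \<subseteq> {y \<in> topspace X. g y \<in> U}" by blast
    qed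
  qed simp
  then have "bounded (g ` topspace X)"
    using pc unfolding pseudocompact_space_def by blast
  then obtain b where b: "\<And>y. y \<in> topspace X \<Longrightarrow> \<bar>g y\<bar> \<le> b"
    unfolding bounded_iff by auto
  obtain n :: nat where n: "b < real n" using reals_Archimedean2 by blast
  obtain N i where N: "x n \<in> N" "\<forall>z\<in>N. g z = real i * f i z"
    using locally[OF x(1)] by blast
  have "Id_on (topspace X) \<subseteq> W" by (rule sectionwise_nhood_Id_on[OF W(1)])
  then have "(x n, x n) \<in> W" using x(1) by blast
  have "{i. f i (x n) \<noteq> 0} = {n}"
    using near[OF x(1) \<open>(x n, x n) \<in> W\<close> \<open>(x n, x n) \<in> W\<close>] f(2)[of n] by force
  then have "g (x n) = real n" by (simp add: g_def f(2))
  then show False using b[OF x(1)[of n]] n by simp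
qed


section \<open>Vector topologies from bases at zero\<close>

text \<open>The usual axioms for a base at zero of a vector topology on a linear subspace \<open>T\<close>. The members
  turn out to be neighbourhoods of zero, in general not open ones.\<close>

locale zero_base =
  fixes T :: "'v::real_vector set" and \<B> :: "'v set set"
  assumes subspace: "subspace T"
    and nonempty: "\<B> \<noteq> {}"
    and subset: "B \<in> \<B> \<Longrightarrow> B \<subseteq> T"
    and directed: "B \<in> \<B> \<Longrightarrow> C \<in> \<B> \<Longrightarrow> \<exists>D\<in>\<B>. D \<subseteq> B \<inter> C"
    and halving: "B \<in> \<B> \<Longrightarrow> \<exists>C\<in>\<B>. C + C \<subseteq> B"
    and balanced: "B \<in> \<B> \<Longrightarrow> u \<in> B \<Longrightarrow> \<bar>c\<bar> \<le> 1 \<Longrightarrow> c *\<^sub>R u \<in> B"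
    and absorbing: "B \<in> \<B> \<Longrightarrow> u \<in> T \<Longrightarrow> \<exists>\<epsilon>>0. \<epsilon> *\<^sub>R u \<in> B"
begin

lemma zero_mem: "B \<in> \<B> \<Longrightarrow> 0 \<in> B"
  using absorbing[of B 0] subspace_0[OF subspace] by auto

definition tvs_topology :: "'v topology" where
  "tvs_topology = topology (\<lambda>U. U \<subseteq> T \<and> (\<forall>u\<in>U. \<exists>B\<in>\<B>. \<forall>b\<in>B. u + b \<in> U))"

lemma openin_tvs_topology:
  "openin tvs_topology U \<longleftrightarrow> U \<subseteq> T \<and> (\<forall>u\<in>U. \<exists>B\<in>\<B>. \<forall>b\<in>B. u + b \<in> U)"
proof -
  have "istopology (\<lambda>U. U \<subseteq> T \<and> (\<forall>u\<in>U. \<exists>B\<in>\<B>. \<forall>b\<in>B. u + b \<in> U))"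
    unfolding istopology_def
  proof (intro conjI allI impI ballI)
    fix U V u
    assume U: "U \<subseteq> T \<and> (\<forall>u\<in>U. \<exists>B\<in>\<B>. \<forall>b\<in>B. u + b \<in> U)"
      and V: "V \<subseteq> T \<and> (\<forall>u\<in>V. \<exists>B\<in>\<B>. \<forall>b\<in>B. u + b \<in> V)"
    then show "U \<inter> V \<subseteq> T" by blast
    assume u: "u \<in> U \<inter> V"
    obtain B where B: "B \<in> \<B>" "\<forall>b\<in>B. u + b \<in> U" using U u by blast
    obtain C where C: "C \<in> \<B>" "\<forall>b\<in>C. u + b \<in> V" using V u by blast
    obtain D where "D \<in> \<B>" "D \<subseteq> B \<inter> C" using directed[OF B(1) C(1)] by blast
    then show "\<exists>B\<in>\<B>. \<forall>b\<in>B. u + b \<in> U \<inter> V" using B(2) C(2) by blast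
  next
    fix \<K> u
    assume K: "\<forall>U\<in>\<K>. U \<subseteq> T \<and> (\<forall>u\<in>U. \<exists>B\<in>\<B>. \<forall>b\<in>B. u + b \<in> U)"
    then show "\<Union>\<K> \<subseteq> T" by blast
    assume "u \<in> \<Union>\<K>"
    then obtain U where "U \<in> \<K>" "u \<in> U" by blast
    moreover obtain B where "B \<in> \<B>" "\<forall>b\<in>B. u + b \<in> U" using K calculation by blast
    ultimately show "\<exists>B\<in>\<B>. \<forall>b\<in>B. u + b \<in> \<Union>\<K>" by blast
  qed
  then show ?thesis by (simp add: tvs_topology_def)
qed

lemma topspace_tvs_topology: "topspace tvs_topology = T"
proof (rule antisym)
  show "topspace tvs_topology \<subseteq> T"
    using openin_tvs_topology[of "topspace tvs_topology"] by auto
  obtain B where B: "B \<in> \<B>" using nonempty by blast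
  have "\<exists>B\<in>\<B>. \<forall>b\<in>B. u + b \<in> T" if "u \<in> T" for u
    using B subset[OF B] subspace_add[OF subspace that] by blast
  then have "openin tvs_topology T"
    by (simp add: openin_tvs_topology)
  then show "T \<subseteq> topspace tvs_topology" by (rule openin_subset)
qed

text \<open>Translates of members of the base are neighbourhoods: the points that have some translated member
  inside \<open>u + B\<close> form an open set, by halving.\<close>

lemma open_core:
  assumes "B \<in> \<B>" "u \<in> T"
  obtains W where "openin tvs_topology W" "u \<in> W" "W \<subseteq> (+) u ` B"
proof
  let ?W = "{w \<in> T. \<exists>C\<in>\<B>. \<forall>c\<in>C. w + c \<in> (+) u ` B}"
  show "openin tvs_topology ?W"
    unfolding openin_tvs_topology
  proof (intro conjI ballI)
    fix w assume w: "w \<in> ?W"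
    then obtain C where C: "C \<in> \<B>" "\<forall>c\<in>C. w + c \<in> (+) u ` B" by blast
    obtain D where D: "D \<in> \<B>" "D + D \<subseteq> C" using halving[OF C(1)] by blast
    have "w + d \<in> ?W" if d: "d \<in> D" for d
    proof -
      have "(w + d) + d' \<in> (+) u ` B" if "d' \<in> D" for d'
      proof -
        have "d + d' \<in> C" using D(2) d that by (meson set_plus_intro subsetD)
        then show ?thesis using C(2) by (simp add: add.assoc)
      qed
      moreover have "w + d \<in> T"
        using w subset[OF D(1)] d subspace_add[OF subspace] by blast
      ultimately show ?thesis using D(1) by blast
    qed
    then show "\<exists>B'\<in>\<B>. \<forall>b\<in>B'. w + b \<in> ?W" using D(1) by blast
  qed blast
  show "u \<in> ?W" using assms by blast
  show "?W \<subseteq> (+) u ` B"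
  proof
    fix w assume "w \<in> ?W"
    then obtain C where C: "C \<in> \<B>" "\<forall>c\<in>C. w + c \<in> (+) u ` B" by blast
    then have "w + 0 \<in> (+) u ` B" using zero_mem[OF C(1)] by blast
    then show "w \<in> (+) u ` B" by simp
  qed
qed

lemma nhood_base_tvs_topology: "nhood_base_at tvs_topology 0 \<B>"
  unfolding nhood_base_at_def
proof (intro conjI ballI allI impI)
  fix B assume B: "B \<in> \<B>"
  show "B \<subseteq> topspace tvs_topology" using subset[OF B] by (simp add: topspace_tvs_topology)
  obtain W where "openin tvs_topology W" "0 \<in> W" "W \<subseteq> (+) 0 ` B"
    using open_core[OF B subspace_0[OF subspace]] .
  then show "\<exists>U. openin tvs_topology U \<and> 0 \<in> U \<and> U \<subseteq> B" by auto
next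
  fix U assume "openin tvs_topology U \<and> 0 \<in> U"
  then obtain B where "B \<in> \<B>" "\<forall>b\<in>B. 0 + b \<in> U"
    unfolding openin_tvs_topology by blast
  then show "\<exists>B\<in>\<B>. B \<subseteq> U" by auto
qed

text \<open>Balancedness handles scalars up to one; halving \<open>k\<close> times handles scalars up to \<open>2 ^ k\<close>.\<close>

lemma bounded_scaling:
  assumes "C \<in> \<B>"
  shows "\<exists>D\<in>\<B>. \<forall>d\<in>D. \<forall>r. \<bar>r\<bar> \<le> 2 ^ k \<longrightarrow> r *\<^sub>R d \<in> C"
  using assms
proof (induction k arbitrary: C)
  case 0
  then show ?case using balanced by auto
next
  case (Suc k)
  obtain C' where C': "C' \<in> \<B>" "C' + C' \<subseteq> C" using halving[OF Suc.prems] by blast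
  obtain D where D: "D \<in> \<B>" "\<forall>d\<in>D. \<forall>r. \<bar>r\<bar> \<le> 2 ^ k \<longrightarrow> r *\<^sub>R d \<in> C'"
    using Suc.IH[OF C'(1)] by blast
  have "r *\<^sub>R d \<in> C" if "d \<in> D" "\<bar>r\<bar> \<le> 2 ^ Suc k" for d r
  proof -
    have "(r / 2) *\<^sub>R d \<in> C'" using D(2) that by auto
    then have "(r / 2) *\<^sub>R d + (r / 2) *\<^sub>R d \<in> C" using C'(2) by (meson set_plus_intro subsetD)
    then show ?thesis by (simp flip: scaleR_add_left)
  qed
  then show ?case using D(1) by blast
qed

lemma continuous_add:
  "continuous_map (prod_topology tvs_topology tvs_topology) tvs_topology (\<lambda>(u, v). u + v)"
  unfolding continuous_map_def
proof (intro conjI allI impI)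
  show "(\<lambda>(u, v). u + v) \<in> topspace (prod_topology tvs_topology tvs_topology) \<rightarrow> topspace tvs_topology"
    using subspace_add[OF subspace] by (auto simp: topspace_tvs_topology)
next
  fix U assume U: "openin tvs_topology U"
  show "openin (prod_topology tvs_topology tvs_topology)
      {z \<in> topspace (prod_topology tvs_topology tvs_topology). (\<lambda>(u, v). u + v) z \<in> U}"
    unfolding openin_prod_topology_alt
  proof (intro allI impI)
    fix u v assume "(u, v) \<in> {z \<in> topspace (prod_topology tvs_topology tvs_topology). (\<lambda>(u, v). u + v) z \<in> U}"
    then have uv: "u \<in> T" "v \<in> T" "u + v \<in> U" by (auto simp: topspace_tvs_topology)
    obtain B where B: "B \<in> \<B>" "\<forall>b\<in>B. u + v + b \<in> U"
      using U uv(3) by (auto simp: openin_tvs_topology)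
    obtain C where C: "C \<in> \<B>" "C + C \<subseteq> B" using halving[OF B(1)] by blast
    obtain M where M: "openin tvs_topology M" "u \<in> M" "M \<subseteq> (+) u ` C" using open_core[OF C(1) uv(1)] .
    obtain N where N: "openin tvs_topology N" "v \<in> N" "N \<subseteq> (+) v ` C" using open_core[OF C(1) uv(2)] .
    have "(u', v') \<in> {z \<in> topspace (prod_topology tvs_topology tvs_topology). (\<lambda>(u, v). u + v) z \<in> U}"
      if m: "u' \<in> M" "v' \<in> N" for u' v'
    proof -
      obtain c d where cd: "c \<in> C" "u' = u + c" "d \<in> C" "v' = v + d" using m M(3) N(3) by blast
      then have "c + d \<in> B" using C(2) by (meson set_plus_intro subsetD)
      then have "u + v + (c + d) \<in> U" using B(2) by blast
      then have "u' + v' \<in> U" using cd by (simp add: algebra_simps)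
      then show ?thesis using m openin_subset[OF M(1)] openin_subset[OF N(1)] by auto
    qed
    then show "\<exists>M N. openin tvs_topology M \<and> openin tvs_topology N \<and> u \<in> M \<and> v \<in> N \<and> M \<times> N \<subseteq>
       {z \<in> topspace (prod_topology tvs_topology tvs_topology). (\<lambda>(u, v). u + v) z \<in> U}"
      by (intro exI[of _ M] exI[of _ N] conjI M N) blast
  qed
qed

lemma continuous_scale:
  "continuous_map (prod_topology euclideanreal tvs_topology) tvs_topology (\<lambda>(c, u). c *\<^sub>R u)"
  unfolding continuous_map_def
proof (intro conjI allI impI)
  show "(\<lambda>(c, u). c *\<^sub>R u) \<in> topspace (prod_topology euclideanreal tvs_topology) \<rightarrow> topspace tvs_topology"
    using subspace_scale[OF subspace] by (auto simp: topspace_tvs_topology)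
next
  fix U assume U: "openin tvs_topology U"
  show "openin (prod_topology euclideanreal tvs_topology)
      {z \<in> topspace (prod_topology euclideanreal tvs_topology). (\<lambda>(c, u). c *\<^sub>R u) z \<in> U}"
    unfolding openin_prod_topology_alt
  proof (intro allI impI)
    fix c u assume "(c, u) \<in> {z \<in> topspace (prod_topology euclideanreal tvs_topology). (\<lambda>(c, u). c *\<^sub>R u) z \<in> U}"
    then have cu: "u \<in> T" "c *\<^sub>R u \<in> U" by (auto simp: topspace_tvs_topology)
    obtain B where B: "B \<in> \<B>" "\<forall>b\<in>B. c *\<^sub>R u + b \<in> U"
      using U cu(2) by (auto simp: openin_tvs_topology)
    obtain C where C: "C \<in> \<B>" "C + C \<subseteq> B" using halving[OF B(1)] by blast
    obtain \<epsilon> where e: "\<epsilon> > 0" "\<epsilon> *\<^sub>R u \<in> C" using absorbing[OF C(1) cu(1)] by blast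
    \<comment> \<open>With \<open>u' = u + d\<close>, the increment \<open>c' u' - c u\<close> is \<open>c' d + (c' - c) u\<close>. The first
      part is small because \<open>c'\<close> is bounded, the second because \<open>u\<close> is absorbed.\<close>
    obtain k :: nat where k: "\<bar>c\<bar> + \<epsilon> < 2 ^ k"
      using real_arch_pow[of 2 "\<bar>c\<bar> + \<epsilon>"] by auto
    obtain D where D: "D \<in> \<B>" "\<forall>d\<in>D. \<forall>r. \<bar>r\<bar> \<le> 2 ^ k \<longrightarrow> r *\<^sub>R d \<in> C"
      using bounded_scaling[OF C(1)] by blast
    obtain N where N: "openin tvs_topology N" "u \<in> N" "N \<subseteq> (+) u ` D" using open_core[OF D(1) cu(1)] .
    have "(c', u') \<in> {z \<in> topspace (prod_topology euclideanreal tvs_topology). (\<lambda>(c, u). c *\<^sub>R u) z \<in> U}"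
      if m: "c' \<in> ball c \<epsilon>" "u' \<in> N" for c' u'
    proof -
      obtain d where d: "d \<in> D" "u' = u + d" using m N(3) by blast
      have c': "\<bar>c' - c\<bar> < \<epsilon>" using m by (simp add: dist_real_def abs_minus_commute)
      then have "\<bar>c'\<bar> \<le> 2 ^ k" using k by linarith
      then have "c' *\<^sub>R d \<in> C" using D(2) d by blast
      moreover have "((c' - c) / \<epsilon>) *\<^sub>R \<epsilon> *\<^sub>R u \<in> C"
        by (rule balanced[OF C(1) e(2)]) (use c' e in \<open>simp add: field_simps\<close>)
      then have "(c' - c) *\<^sub>R u \<in> C" using e by simp
      ultimately have "c' *\<^sub>R d + (c' - c) *\<^sub>R u \<in> B" using C(2) by (meson set_plus_intro subsetD)
      then have "c *\<^sub>R u + (c' *\<^sub>R d + (c' - c) *\<^sub>R u) \<in> U" using B(2) by blast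
      then have "c' *\<^sub>R u' \<in> U" using d by (simp add: algebra_simps)
      then show ?thesis using m openin_subset[OF N(1)] by auto
    qed
    then show "\<exists>M N. openin euclideanreal M \<and> openin tvs_topology N \<and> c \<in> M \<and> u \<in> N \<and> M \<times> N \<subseteq>
       {z \<in> topspace (prod_topology euclideanreal tvs_topology). (\<lambda>(c, u). c *\<^sub>R u) z \<in> U}"
      using N e by (intro exI[of _ "ball c \<epsilon>"] exI[of _ N] conjI) (auto simp: subset_iff)
  qed
qed

lemma tvs_tvs_topology: "tvs tvs_topology"
  unfolding tvs_def topspace_tvs_topology
  using subspace continuous_add continuous_scale by blast

lemma lcs_tvs_topology:
  assumes "\<And>B. B \<in> \<B> \<Longrightarrow> convex B"
  shows "lcs tvs_topology"
  unfolding lcs_def neighbourhood_base_at_def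
proof (intro conjI tvs_tvs_topology allI impI)
  fix W assume "openin tvs_topology W \<and> 0 \<in> W"
  then obtain B where B: "B \<in> \<B>" "B \<subseteq> W"
    using nhood_base_tvs_topology unfolding nhood_base_at_def by meson
  then obtain U where "openin tvs_topology U" "0 \<in> U" "U \<subseteq> B"
    using nhood_base_tvs_topology unfolding nhood_base_at_def by meson
  then show "\<exists>U V. openin tvs_topology U \<and> convex V \<and> 0 \<in> U \<and> U \<subseteq> V \<and> V \<subseteq> W"
    using B assms by blast
qed

text \<open>Halving survives because the convex hull of \<open>C + C\<close> is the sum of the convex hulls.\<close>

lemma zero_base_convex_hulls: "zero_base T ((\<lambda>B. convex hull B) ` \<B>)"
proof (unfold_locales; (elim imageE)?; clarify?)
  show "\<exists>D\<in>(\<lambda>B. convex hull B) ` \<B>. D \<subseteq> convex hull B \<inter> convex hull C"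
    if BC: "B \<in> \<B>" "C \<in> \<B>" for B C
  proof -
    obtain D where "D \<in> \<B>" "D \<subseteq> B \<inter> C" using directed[OF BC] by blast
    then show ?thesis
      by (intro bexI[of _ "convex hull D"]) (auto intro: hull_mono[THEN subsetD])
  qed
  show "\<exists>C\<in>(\<lambda>B. convex hull B) ` \<B>. C + C \<subseteq> convex hull B" if B: "B \<in> \<B>" for B
  proof -
    obtain C where "C \<in> \<B>" "C + C \<subseteq> B" using halving[OF B] by blast
    then show ?thesis
      by (intro bexI[of _ "convex hull C"]) (auto simp flip: convex_hull_set_plus intro: hull_mono[THEN subsetD])
  qed
  show "c *\<^sub>R u \<in> convex hull B" if "B \<in> \<B>" "u \<in> convex hull B" "\<bar>c\<bar> \<le> 1" for B c u
  proof -
    have "c *\<^sub>R u \<in> convex hull ((\<lambda>x. c *\<^sub>R x) ` B)"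
      unfolding convex_hull_scaling using that(2) by (rule imageI)
    moreover have "(\<lambda>x. c *\<^sub>R x) ` B \<subseteq> B"
      using balanced[OF that(1) _ that(3)] by blast
    ultimately show ?thesis using hull_mono by blast
  qed
  show "\<exists>\<epsilon>>0. \<epsilon> *\<^sub>R u \<in> convex hull B" if "B \<in> \<B>" "u \<in> T" for B u
    using absorbing[OF that] hull_inc by metis
  show "u \<in> T" if "B \<in> \<B>" "u \<in> convex hull B" for B u
    using that(2) hull_minimal[of B T convex, OF subset[OF that(1)] subspace_imp_convex[OF subspace]] by blast
qed (use subspace nonempty in auto)

end

section \<open>Sets of finite sums\<close>

text \<open>Both infinite sums of the theorem are of this form, with terms indexed from \<open>1\<close>; the
  properties that matter are inherited from those of the individual sets \<open>A n\<close>.\<close>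

definition series_set :: "(nat \<Rightarrow> 'v::real_vector set) \<Rightarrow> 'v set" where
  "series_set A = (\<Union>m\<in>{1..}. {(\<Sum>n=1..m. a n) | a. \<forall>n\<in>{1..m}. a n \<in> A n})"

lemma series_setI:
  assumes "m \<ge> 1" "\<And>n. n \<in> {1..m} \<Longrightarrow> a n \<in> A n"
  shows "(\<Sum>n=1..m. a n) \<in> series_set A"
  unfolding series_set_def using assms by blast

lemma series_set_mono:
  assumes "\<And>n. n \<ge> 1 \<Longrightarrow> A n \<subseteq> B n"
  shows "series_set A \<subseteq> series_set B"
proof
  fix v assume "v \<in> series_set A"
  then obtain m a where "m \<ge> 1" "\<forall>n\<in>{1..m}. a n \<in> A n" "v = (\<Sum>n=1..m. a n)"
    unfolding series_set_def by auto
  moreover from this have "(\<Sum>n=1..m. a n) \<in> series_set B"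
    using assms by (intro series_setI) (meson atLeastAtMost_iff subsetD)+
  ultimately show "v \<in> series_set B" by simp
qed

text \<open>Padding with zeros lets two sums of different lengths be brought to a common length.\<close>

lemma series_set_padded:
  assumes "v \<in> series_set A" "\<And>n. n \<ge> 1 \<Longrightarrow> 0 \<in> A n"
  obtains m a where "\<And>n. n \<ge> 1 \<Longrightarrow> a n \<in> A n" "\<And>k. k \<ge> m \<Longrightarrow> v = (\<Sum>n=1..k. a n)"
proof -
  obtain m a where a: "m \<ge> 1" "\<forall>n\<in>{1..m}. a n \<in> A n" "v = (\<Sum>n=1..m. a n)"
    using assms(1) unfolding series_set_def by auto
  show thesis
  proof
    show "(if n \<le> m then a n else 0) \<in> A n" if "n \<ge> 1" for n
      using a(2) assms(2) that by auto
    show "v = (\<Sum>n=1..k. if n \<le> m then a n else 0)" if "k \<ge> m" for k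
    proof -
      have "(\<Sum>n=1..k. if n \<le> m then a n else 0) = (\<Sum>n\<in>{1..k} \<inter> {n. n \<le> m}. a n)"
        by (simp add: sum.inter_restrict)
      also have "{1..k} \<inter> {n. n \<le> m} = {1..m}" using that by auto
      finally show ?thesis using a(3) by simp
    qed
  qed
qed

lemma sum_interleave:
  fixes c :: "nat \<Rightarrow> 'v::comm_monoid_add"
  shows "(\<Sum>n=1..2*k. c n) = (\<Sum>n=1..k. c (2 * n - 1)) + (\<Sum>n=1..k. c (2 * n))"
  by (induction k) (simp_all add: algebra_simps)

text \<open>The terms of the first sum are put at the odd places and those of the second at the even places.\<close>

lemma series_set_interleave:
  assumes "\<And>n. n \<ge> 1 \<Longrightarrow> 0 \<in> A n" "\<And>n. n \<ge> 1 \<Longrightarrow> A n \<subseteq> B (2 * n - 1) \<inter> B (2 * n)"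
  shows "series_set A + series_set A \<subseteq> series_set B"
proof (rule subsetI, elim set_plus_elim)
  fix u v w assume uvw: "w = u + v" "u \<in> series_set A" "v \<in> series_set A"
  obtain k a where a: "\<And>n. n \<ge> 1 \<Longrightarrow> a n \<in> A n" "\<And>m. m \<ge> k \<Longrightarrow> u = (\<Sum>n=1..m. a n)"
    using series_set_padded[OF uvw(2) assms(1)] by metis
  obtain l b where b: "\<And>n. n \<ge> 1 \<Longrightarrow> b n \<in> A n" "\<And>m. m \<ge> l \<Longrightarrow> v = (\<Sum>n=1..m. b n)"
    using series_set_padded[OF uvw(3) assms(1)] by metis
  define m where "m = k + l + 1"
  define c where "c n = (if even n then b (n div 2) else a (Suc n div 2))" for n
  have "(\<Sum>n=1..2*m. c n) \<in> series_set B"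
  proof (rule series_setI)
    fix n assume "n \<in> {1..2 * m}"
    then have n: "n \<ge> 1" by simp
    show "c n \<in> B n"
    proof (cases "even n")
      case True
      then obtain j where "n = 2 * j" by blast
      then show ?thesis using n b(1)[of j] assms(2)[of j] by (auto simp: c_def)
    next
      case False
      then obtain j where "n = 2 * j + 1" using oddE by blast
      then show ?thesis using a(1)[of "Suc j"] assms(2)[of "Suc j"] by (auto simp: c_def)
    qed
  qed (simp add: m_def)
  also have "(\<Sum>n=1..2*m. c n) = (\<Sum>n=1..m. a n) + (\<Sum>n=1..m. b n)"
    unfolding sum_interleave
    by (intro arg_cong2[where f = "(+)"] sum.cong) (auto simp: c_def)
  also have "\<dots> = w"
    using a(2)[of m] b(2)[of m] uvw(1) by (simp add: m_def)
  finally show "w \<in> series_set B" .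
qed

lemma series_set_scale:
  assumes "\<And>n u. n \<ge> 1 \<Longrightarrow> u \<in> A n \<Longrightarrow> c *\<^sub>R u \<in> A n" "v \<in> series_set A"
  shows "c *\<^sub>R v \<in> series_set A"
proof -
  obtain m a where a: "m \<ge> 1" "\<forall>n\<in>{1..m}. a n \<in> A n" "v = (\<Sum>n=1..m. a n)"
    using assms(2) unfolding series_set_def by auto
  have "(\<Sum>n=1..m. c *\<^sub>R a n) \<in> series_set A"
    by (rule series_setI) (use a assms(1) in auto)
  then show ?thesis by (simp add: a(3) scaleR_sum_right)
qed

lemma series_set_first:
  assumes "u \<in> A 1"
  shows "u \<in> series_set A"
  using series_setI[of 1 "\<lambda>_. u" A] assms by simp

lemma series_set_subset_subspace:
  assumes "subspace T" "\<And>n. n \<ge> 1 \<Longrightarrow> A n \<subseteq> T"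
  shows "series_set A \<subseteq> T"
proof
  fix v assume "v \<in> series_set A"
  then obtain m a where a: "\<forall>n\<in>{1..m}. a n \<in> A n" "v = (\<Sum>n=1..m. a n)"
    unfolding series_set_def by auto
  then have "\<And>n. n \<in> {1..m} \<Longrightarrow> a n \<in> T"
    using assms(2) by (meson atLeastAtMost_iff subsetD)
  then show "v \<in> T" unfolding a(2) by (rule subspace_sum[OF assms(1)])
qed

definition small_differences :: "('a \<times> 'a) set \<Rightarrow> ('a \<Rightarrow>\<^sub>0 real) set" where
  "small_differences V = {t *\<^sub>R (gen x - gen y) | t x y. \<bar>t\<bar> \<le> 1 \<and> (x, y) \<in> V}"

definition small_multiples :: "'a set \<Rightarrow> ('a \<Rightarrow> nat) \<Rightarrow> ('a \<Rightarrow>\<^sub>0 real) set" where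
  "small_multiples S \<phi> = {t *\<^sub>R gen x | t x. x \<in> S \<and> \<bar>t\<bar> \<le> 1 / real (\<phi> x)}"

lemma small_differencesI:
  "\<bar>t\<bar> \<le> 1 \<Longrightarrow> (x, y) \<in> V \<Longrightarrow> t *\<^sub>R (gen x - gen y) \<in> small_differences V"
  unfolding small_differences_def by blast

lemma small_multiplesI:
  "x \<in> S \<Longrightarrow> \<bar>t\<bar> \<le> 1 / real (\<phi> x) \<Longrightarrow> t *\<^sub>R gen x \<in> small_multiples S \<phi>"
  unfolding small_multiples_def by blast

lemma entourage_sum_eq: "entourage_sum V = series_set (\<lambda>n. small_differences (V n))"
proof (intro equalityI subsetI)
  fix v assume "v \<in> entourage_sum V"
  then obtain m t x y where "m \<ge> 1" "v = (\<Sum>n=1..m. t n *\<^sub>R (gen (x n) - gen (y n)))"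
    "\<forall>n\<in>{1..m}. \<bar>t n\<bar> \<le> 1 \<and> (x n, y n) \<in> V n"
    unfolding entourage_sum_def by auto
  moreover from this have "(\<Sum>n=1..m. t n *\<^sub>R (gen (x n) - gen (y n)))
      \<in> series_set (\<lambda>n. small_differences (V n))"
    by (intro series_setI) (blast intro: small_differencesI)+
  ultimately show "v \<in> series_set (\<lambda>n. small_differences (V n))" by simp
next
  fix v assume "v \<in> series_set (\<lambda>n. small_differences (V n))"
  then obtain m a where m: "m \<ge> 1" "\<forall>n\<in>{1..m}. a n \<in> small_differences (V n)" "v = (\<Sum>n=1..m. a n)"
    unfolding series_set_def by auto
  then have "\<forall>n\<in>{1..m}. \<exists>t x y. a n = t *\<^sub>R (gen x - gen y) \<and> \<bar>t\<bar> \<le> 1 \<and> (x, y) \<in> V n"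
    unfolding small_differences_def by blast
  then obtain t x y where txy: "\<forall>n\<in>{1..m}. a n = t n *\<^sub>R (gen (x n) - gen (y n)) \<and> \<bar>t n\<bar> \<le> 1 \<and> (x n, y n) \<in> V n"
    by metis
  then have "v = (\<Sum>n=1..m. t n *\<^sub>R (gen (x n) - gen (y n)))"
    unfolding m(3) by (intro sum.cong) auto
  then show "v \<in> entourage_sum V"
    unfolding entourage_sum_def using m(1) txy by blast
qed

lemma reciprocal_sum_eq: "reciprocal_sum S \<phi> = series_set (\<lambda>n. small_multiples S (\<phi> n))"
proof (intro equalityI subsetI)
  fix v assume "v \<in> reciprocal_sum S \<phi>"
  then obtain m t x where "m \<ge> 1" "v = (\<Sum>n=1..m. t n *\<^sub>R gen (x n))"
    "\<forall>n\<in>{1..m}. x n \<in> S \<and> \<bar>t n\<bar> \<le> 1 / real (\<phi> n (x n))"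
    unfolding reciprocal_sum_def by auto
  moreover from this have "(\<Sum>n=1..m. t n *\<^sub>R gen (x n))
      \<in> series_set (\<lambda>n. small_multiples S (\<phi> n))"
    by (intro series_setI) (blast intro: small_multiplesI)+
  ultimately show "v \<in> series_set (\<lambda>n. small_multiples S (\<phi> n))" by simp
next
  fix v assume "v \<in> series_set (\<lambda>n. small_multiples S (\<phi> n))"
  then obtain m a where m: "m \<ge> 1" "\<forall>n\<in>{1..m}. a n \<in> small_multiples S (\<phi> n)" "v = (\<Sum>n=1..m. a n)"
    unfolding series_set_def by auto
  then have "\<forall>n\<in>{1..m}. \<exists>t x. a n = t *\<^sub>R gen x \<and> x \<in> S \<and> \<bar>t\<bar> \<le> 1 / real (\<phi> n x)"
    unfolding small_multiples_def by blast
  then obtain t x where tx: "\<forall>n\<in>{1..m}. a n = t n *\<^sub>R gen (x n) \<and> x n \<in> S \<and> \<bar>t n\<bar> \<le> 1 / real (\<phi> n (x n))"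
    by metis
  then have "v = (\<Sum>n=1..m. t n *\<^sub>R gen (x n))"
    unfolding m(3) by (intro sum.cong) auto
  then show "v \<in> reciprocal_sum S \<phi>"
    unfolding reciprocal_sum_def using m(1) tx by blast
qed

lemma small_differences_mono: "V \<subseteq> W \<Longrightarrow> small_differences V \<subseteq> small_differences W"
  unfolding small_differences_def by blast

lemma small_differences_scale:
  assumes "v \<in> small_differences V" "\<bar>c\<bar> \<le> 1"
  shows "c *\<^sub>R v \<in> small_differences V"
proof -
  obtain t x y where v: "v = t *\<^sub>R (gen x - gen y)" "\<bar>t\<bar> \<le> 1" "(x, y) \<in> V"
    using assms(1) unfolding small_differences_def by blast
  have "\<bar>c * t\<bar> \<le> 1"
    using assms(2) v(2) by (simp add: abs_mult mult_le_one)
  moreover have "c *\<^sub>R v = (c * t) *\<^sub>R (gen x - gen y)"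
    by (simp add: v(1))
  ultimately show ?thesis
    unfolding small_differences_def using v(3) by blast
qed

lemma zero_in_small_differences:
  assumes "V \<noteq> {}"
  shows "0 \<in> small_differences V"
proof -
  obtain x y where "(x, y) \<in> V" using assms by auto
  then have "0 *\<^sub>R (gen x - gen y) \<in> small_differences V"
    unfolding small_differences_def by (intro CollectI exI conjI) auto
  then show ?thesis by simp
qed

lemma small_differences_subset:
  assumes "V \<subseteq> S \<times> S"
  shows "small_differences V \<subseteq> free_vector_space S"
  unfolding small_differences_def using assms
  by (auto intro!: subspace_scale subspace_diff subspace_free_vector_space gen_in_free_vector_space)

lemma small_multiples_antimono:
  assumes "\<And>x. x \<in> S \<Longrightarrow> 1 \<le> \<phi> x" "\<And>x. x \<in> S \<Longrightarrow> \<phi> x \<le> \<psi> x"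
  shows "small_multiples S \<psi> \<subseteq> small_multiples S \<phi>"
proof
  fix v assume "v \<in> small_multiples S \<psi>"
  then obtain t x where v: "v = t *\<^sub>R gen x" "x \<in> S" "\<bar>t\<bar> \<le> 1 / real (\<psi> x)"
    unfolding small_multiples_def by blast
  have "1 / real (\<psi> x) \<le> 1 / real (\<phi> x)"
    by (rule divide_left_mono) (use assms[OF v(2)] in auto)
  then show "v \<in> small_multiples S \<phi>"
    unfolding small_multiples_def using v order_trans by blast
qed

lemma small_multiples_scale:
  assumes "v \<in> small_multiples S \<phi>" "\<bar>c\<bar> \<le> 1"
  shows "c *\<^sub>R v \<in> small_multiples S \<phi>"
proof -
  obtain t x where v: "v = t *\<^sub>R gen x" "x \<in> S" "\<bar>t\<bar> \<le> 1 / real (\<phi> x)"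
    using assms(1) unfolding small_multiples_def by blast
  have "\<bar>c * t\<bar> \<le> 1 * (1 / real (\<phi> x))"
    unfolding abs_mult by (rule mult_mono) (use assms v in auto)
  moreover have "c *\<^sub>R v = (c * t) *\<^sub>R gen x"
    by (simp add: v(1))
  ultimately show ?thesis
    unfolding small_multiples_def using v(2) by auto
qed

lemma zero_in_small_multiples:
  assumes "S \<noteq> {}"
  shows "0 \<in> small_multiples S \<phi>"
proof -
  obtain x where "x \<in> S" using assms by auto
  then have "0 *\<^sub>R gen x \<in> small_multiples S \<phi>"
    unfolding small_multiples_def by (intro CollectI exI conjI) auto
  then show ?thesis by simp
qed

lemma small_multiples_subset: "small_multiples S \<phi> \<subseteq> free_vector_space S"
  unfolding small_multiples_def
  by (auto intro!: subspace_scale subspace_free_vector_space gen_in_free_vector_space)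

section \<open>Shrinking neighbourhoods in topological vector spaces\<close>

lemma tvs_continuous_plus:
  assumes "tvs E" "continuous_map Y E f" "continuous_map Y E g"
  shows "continuous_map Y E (\<lambda>y. f y + g y)"
proof -
  have "continuous_map Y (prod_topology E E) (\<lambda>y. (f y, g y))"
    using assms(2,3) by (rule continuous_map_pairedI)
  moreover have "continuous_map (prod_topology E E) E (\<lambda>(u, v). u + v)"
    using assms(1) by (simp add: tvs_def)
  ultimately show ?thesis
    using continuous_map_compose by (fastforce simp: o_def)
qed

lemma tvs_continuous_scaleR:
  assumes "tvs E" "continuous_map Y euclideanreal f" "continuous_map Y E g"
  shows "continuous_map Y E (\<lambda>y. f y *\<^sub>R g y)"
proof -
  have "continuous_map Y (prod_topology euclideanreal E) (\<lambda>y. (f y, g y))"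
    using assms(2,3) by (rule continuous_map_pairedI)
  moreover have "continuous_map (prod_topology euclideanreal E) E (\<lambda>(c, u). c *\<^sub>R u)"
    using assms(1) by (simp add: tvs_def)
  ultimately show ?thesis
    using continuous_map_compose by (fastforce simp: o_def)
qed

lemma tvs_zero_in_topspace: "tvs E \<Longrightarrow> 0 \<in> topspace E"
  by (simp add: tvs_def subspace_0)

text \<open>The scalars \<open>c\<close> and \<open>d\<close> make it possible to use neighbourhoods that are open but not
  balanced.\<close>

definition shrinking_nhoods :: "'v::real_vector topology \<Rightarrow> (nat \<Rightarrow> 'v set) \<Rightarrow> bool" where
  "shrinking_nhoods E U \<longleftrightarrow>
     (\<forall>n. openin E (U n) \<and> 0 \<in> U n \<and>
          (\<forall>u\<in>U (Suc n). \<forall>v\<in>U (Suc n). \<forall>c d. \<bar>c\<bar> \<le> 1 \<longrightarrow> \<bar>d\<bar> \<le> 1 \<longrightarrow> c *\<^sub>R u + d *\<^sub>R v \<in> U n))"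

text \<open>By continuity of addition it is enough to keep \<open>c u\<close> and \<open>d v\<close> in two given
  neighbourhoods. Continuity of scalar multiplication at \<open>(0, 0)\<close> gives this for scalars below
  some \<open>\<delta>\<close> and vectors in some \<open>N\<close>; rescaling \<open>N\<close> by \<open>\<delta> / 2\<close> brings the
  scalars up to one.\<close>

lemma tvs_smaller_nhood:
  assumes E: "tvs E" and U: "openin E U" "0 \<in> U"
  obtains W where "openin E W" "0 \<in> W"
    "\<And>u v c d. u \<in> W \<Longrightarrow> v \<in> W \<Longrightarrow> \<bar>c\<bar> \<le> 1 \<Longrightarrow> \<bar>d\<bar> \<le> 1 \<Longrightarrow> c *\<^sub>R u + d *\<^sub>R v \<in> U"
proof -
  let ?Q = "{z \<in> topspace (prod_topology E E). (\<lambda>(u, v). u + v) z \<in> U}"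
  have "openin (prod_topology E E) ?Q"
    by (rule openin_continuous_map_preimage[OF _ U(1)]) (use E in \<open>simp add: tvs_def\<close>)
  moreover have "(0, 0) \<in> ?Q"
    using U(2) tvs_zero_in_topspace[OF E] by simp
  ultimately obtain A B where AB: "openin E A" "openin E B" "0 \<in> A" "0 \<in> B" "A \<times> B \<subseteq> ?Q"
    unfolding openin_prod_topology_alt by meson
  let ?R = "{z \<in> topspace (prod_topology euclideanreal E). (\<lambda>(c, u). c *\<^sub>R u) z \<in> A \<inter> B}"
  have "openin (prod_topology euclideanreal E) ?R"
    by (rule openin_continuous_map_preimage[OF _ openin_Int[OF AB(1,2)]]) (use E in \<open>simp add: tvs_def\<close>)
  moreover have "(0, 0) \<in> ?R"
    using AB tvs_zero_in_topspace[OF E] by simp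
  ultimately obtain M N where MN: "open M" "openin E N" "0 \<in> M" "0 \<in> N" "M \<times> N \<subseteq> ?R"
    unfolding openin_prod_topology_alt open_openin[symmetric] by meson
  obtain \<delta> where d: "\<delta> > 0" "ball 0 \<delta> \<subseteq> M"
    using MN(1,3) open_contains_ball by blast
  let ?W = "{u \<in> topspace E. (2 / \<delta>) *\<^sub>R u \<in> N}"
  have "continuous_map E E (\<lambda>u. (2 / \<delta>) *\<^sub>R u)"
    by (rule tvs_continuous_scaleR[OF E]) (simp_all add: continuous_map_id[unfolded id_def])
  then have "openin E ?W"
    using MN(2) by (rule openin_continuous_map_preimage)
  moreover have "0 \<in> ?W"
    using MN(4) tvs_zero_in_topspace[OF E] by simp
  moreover have "c *\<^sub>R u + c' *\<^sub>R v \<in> U" if uv: "u \<in> ?W" "v \<in> ?W" "\<bar>c\<bar> \<le> 1" "\<bar>c'\<bar> \<le> 1" for u v c c'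
  proof -
    have scaled: "c *\<^sub>R u \<in> A \<inter> B" if u: "u \<in> ?W" and c: "\<bar>c\<bar> \<le> 1" for u c
    proof -
      have "\<bar>c\<bar> * \<delta> \<le> 1 * \<delta>"
        by (rule mult_right_mono) (use c d in auto)
      then have "c * \<delta> / 2 \<in> ball 0 \<delta>"
        using d(1) by (simp add: abs_mult)
      then have "(c * \<delta> / 2, (2 / \<delta>) *\<^sub>R u) \<in> M \<times> N"
        using d(2) u by auto
      from subsetD[OF MN(5) this]
      have "(c * \<delta> / 2) *\<^sub>R ((2 / \<delta>) *\<^sub>R u) \<in> A \<inter> B"
        by simp
      then show ?thesis using d(1) by simp
    qed
    have "(c *\<^sub>R u, c' *\<^sub>R v) \<in> A \<times> B"
      using scaled[OF uv(1,3)] scaled[OF uv(2,4)] by blast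
    from subsetD[OF AB(5) this] show ?thesis by simp
  qed
  ultimately show thesis by (rule that)
qed

lemma tvs_shrinking_nhoods:
  assumes E: "tvs E" and U: "openin E U" "0 \<in> U"
  obtains W where "shrinking_nhoods E W" "W 0 = U"
proof -
  let ?P = "\<lambda>n W. openin E W \<and> 0 \<in> W \<and> (n = (0::nat) \<longrightarrow> W = U)"
  let ?Q = "\<lambda>n W W'. \<forall>u\<in>W'. \<forall>v\<in>W'. \<forall>c d. \<bar>c\<bar> \<le> 1 \<longrightarrow> \<bar>d\<bar> \<le> 1 \<longrightarrow> c *\<^sub>R u + d *\<^sub>R v \<in> W"
  obtain W where W: "\<forall>n. ?P n (W n) \<and> ?Q n (W n) (W (Suc n))"
  proof (rule exE[OF dependent_nat_choice[where P = ?P and Q = ?Q]])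
    show "\<exists>W. ?P 0 W" using U by auto
    show "\<exists>W'. ?P (Suc n) W' \<and> ?Q n W W'" if "?P n W" for W n
    proof -
      obtain W' where "openin E W'" "0 \<in> W'"
        "\<And>u v c d. u \<in> W' \<Longrightarrow> v \<in> W' \<Longrightarrow> \<bar>c\<bar> \<le> 1 \<Longrightarrow> \<bar>d\<bar> \<le> 1 \<Longrightarrow> c *\<^sub>R u + d *\<^sub>R v \<in> W"
        using tvs_smaller_nhood[OF E, of W] \<open>?P n W\<close> by metis
      then show ?thesis by (intro exI[of _ W']) auto
    qed
  qed
  then have "shrinking_nhoods E W"
    unfolding shrinking_nhoods_def by blast
  moreover have "W 0 = U" using W by blast
  ultimately show thesis by (rule that)
qed

lemma shrinking_nhoods_combination:
  assumes "shrinking_nhoods E U" "u \<in> U (Suc n)" "v \<in> U (Suc n)" "\<bar>c\<bar> \<le> 1" "\<bar>d\<bar> \<le> 1"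
  shows "c *\<^sub>R u + d *\<^sub>R v \<in> U n"
proof -
  have "\<forall>u\<in>U (Suc n). \<forall>v\<in>U (Suc n). \<forall>c d. \<bar>c\<bar> \<le> 1 \<longrightarrow> \<bar>d\<bar> \<le> 1 \<longrightarrow> c *\<^sub>R u + d *\<^sub>R v \<in> U n"
    using assms(1) by (simp add: shrinking_nhoods_def)
  then show ?thesis using assms(2-) by blast
qed

lemma shrinking_nhoods_plus:
  assumes "shrinking_nhoods E U" "u \<in> U (Suc n)" "v \<in> U (Suc n)"
  shows "u + v \<in> U n"
  using shrinking_nhoods_combination[OF assms, of 1 1] by simp

lemma shrinking_nhoods_scale:
  assumes "shrinking_nhoods E U" "u \<in> U (Suc n)" "\<bar>c\<bar> \<le> 1"
  shows "c *\<^sub>R u \<in> U n"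
  using shrinking_nhoods_combination[OF assms(1,2,2,3), of 0] by simp

text \<open>The first term lies in \<open>U (k + 1)\<close>, and so does the sum of the others by induction.\<close>

lemma shrinking_nhoods_sum:
  assumes "shrinking_nhoods E U" "\<And>n. n \<in> {1..m} \<Longrightarrow> a n \<in> U (k + n)"
  shows "(\<Sum>n=1..m. a n) \<in> U k"
  using assms(2)
proof (induction m arbitrary: a k)
  case 0
  then show ?case using assms(1) by (simp add: shrinking_nhoods_def)
next
  case (Suc m)
  have "(\<Sum>n=1..m. a (Suc n)) \<in> U (Suc k)"
  proof (rule Suc.IH)
    show "a (Suc n) \<in> U (Suc k + n)" if "n \<in> {1..m}" for n
      using Suc.prems[of "Suc n"] that by simp
  qed
  moreover have "a 1 \<in> U (Suc k)" using Suc.prems[of 1] by simp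
  ultimately have "a 1 + (\<Sum>n=1..m. a (Suc n)) \<in> U k"
    using shrinking_nhoods_plus[OF assms(1)] by blast
  also have "a 1 + (\<Sum>n=1..m. a (Suc n)) = (\<Sum>n=1..Suc m. a n)"
    by (simp add: sum.atLeast_Suc_atMost sum.shift_bounds_cl_Suc_ivl del: sum.cl_ivl_Suc)
  finally show ?case .
qed

lemma shrinking_nhoods_series:
  assumes "shrinking_nhoods E U" "\<And>n. n \<ge> 1 \<Longrightarrow> A n \<subseteq> U (k + n)"
  shows "series_set A \<subseteq> U k"
proof
  fix v assume "v \<in> series_set A"
  then obtain m a where "\<forall>n\<in>{1..m}. a n \<in> A n" "v = (\<Sum>n=1..m. a n)"
    unfolding series_set_def by auto
  moreover have "(\<Sum>n=1..m. a n) \<in> U k"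
  proof (rule shrinking_nhoods_sum[OF assms(1)])
    show "a n \<in> U (k + n)" if "n \<in> {1..m}" for n
      using assms(2)[of n] calculation(1) that by auto
  qed
  ultimately show "v \<in> U k" by simp
qed

text \<open>A vector topology induces a uniformity, and a continuous map into it is uniformly continuous for the
  universal uniformity: the preimages of a shrinking sequence of neighbourhoods, made symmetric, form
  a normal sequence.\<close>

lemma difference_entourage:
  assumes E: "tvs E" and f: "continuous_map X E f" and U: "openin E U" "0 \<in> U"
  shows "{(x, y) \<in> topspace X \<times> topspace X. f x - f y \<in> U} \<in> normal_entourages X"
proof -
  obtain O' where O': "shrinking_nhoods E O'" "O' 0 = U"
    using tvs_shrinking_nhoods[OF E U] .
  define W where "W n = {(x, y) \<in> topspace X \<times> topspace X. f x - f y \<in> O' n \<and> f y - f x \<in> O' n}" for n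
  have "normal_sequence X W"
    unfolding normal_sequence_def
  proof (intro allI conjI)
    fix n
    have O'n: "openin E (O' n)" "0 \<in> O' n"
      using O'(1) by (auto simp: shrinking_nhoods_def)
    show "sectionwise_nhood X (W n)"
      unfolding sectionwise_nhood_def
    proof (intro conjI ballI)
      fix x assume x: "x \<in> topspace X"
      have fx: "continuous_map X E (\<lambda>_. f x)"
        using x continuous_map_image_subset_topspace[OF f] by auto
      have neg: "continuous_map X E (\<lambda>y. (-1) *\<^sub>R g y)" if "continuous_map X E g" for g
        using that by (intro tvs_continuous_scaleR[OF E]) auto
      have "continuous_map X E (\<lambda>y. f x - f y)" "continuous_map X E (\<lambda>y. f y - f x)"
        using tvs_continuous_plus[OF E fx neg[OF f]] tvs_continuous_plus[OF E f neg[OF fx]] by simp_all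
      then have "openin X ({y \<in> topspace X. f x - f y \<in> O' n} \<inter> {y \<in> topspace X. f y - f x \<in> O' n})"
        (is "openin X ?N") using O'n(1) by (intro openin_Int openin_continuous_map_preimage) auto
      then show "\<exists>N. openin X N \<and> x \<in> N \<and> N \<subseteq> W n `` {x}"
        by (intro exI[of _ ?N]) (use x O'n(2) in \<open>auto simp: W_def\<close>)
    qed (auto simp: W_def)
    show "sym (W n)" by (auto simp: W_def sym_def)
    show "W (Suc n) O W (Suc n) \<subseteq> W n"
    proof clarify
      fix x y z assume h: "(x, y) \<in> W (Suc n)" "(y, z) \<in> W (Suc n)"
      have "(f x - f y) + (f y - f z) \<in> O' n" "(f z - f y) + (f y - f x) \<in> O' n"
        by (rule shrinking_nhoods_plus[OF O'(1)]; use h in \<open>simp add: W_def\<close>)+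
      then show "(x, z) \<in> W n" using h by (auto simp: W_def)
    qed
  qed
  moreover have "W 0 \<subseteq> {(x, y) \<in> topspace X \<times> topspace X. f x - f y \<in> U}"
    using O'(2) by (auto simp: W_def)
  ultimately show ?thesis
    unfolding normal_entourages_def by blast
qed

lemma scalar_multiples_small:
  assumes "tvs E" "u \<in> topspace E" "openin E U" "0 \<in> U"
  shows "\<exists>k::nat\<ge>1. \<forall>t. \<bar>t\<bar> \<le> 1 / real k \<longrightarrow> t *\<^sub>R u \<in> U"
proof -
  have "continuous_map euclideanreal E (\<lambda>t. t *\<^sub>R u)"
    by (rule tvs_continuous_scaleR[OF assms(1)]) (use assms(2) in \<open>simp_all add: continuous_map_id[unfolded id_def]\<close>)
  then have "openin euclideanreal {t \<in> topspace euclideanreal. t *\<^sub>R u \<in> U}"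
    using assms(3) by (rule openin_continuous_map_preimage)
  then have "open {t. t *\<^sub>R u \<in> U}" by simp
  then obtain e where e: "e > 0" "ball 0 e \<subseteq> {t. t *\<^sub>R u \<in> U}"
    using assms(4) open_contains_ball by (metis mem_Collect_eq scale_zero_left)
  obtain k where k: "k > 0" "1 / real k < e"
    using e(1) by (metis nat_approx_posE zero_less_Suc)
  then have "t *\<^sub>R u \<in> U" if "\<bar>t\<bar> \<le> 1 / real k" for t
    using e(2) that by (force simp: dist_real_def)
  then show ?thesis using k(1) by (intro exI[of _ k]) auto
qed

section \<open>The sums generate a vector topology\<close>

lemmas normal_entourages_Int = uniformity_of_set_Int[OF uniformity_of_set_normal_entourages]
lemmas normal_entourages_between = uniformity_of_set_between[OF uniformity_of_set_normal_entourages]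

lemma base_family_eq:
  assumes "completely_regular_space X"
  shows "base_family X =
    {series_set (\<lambda>n. small_differences (V n)) + series_set (\<lambda>n. small_multiples (topspace X) (\<phi> n)) | V \<phi>.
      (\<forall>n\<ge>1. V n \<in> normal_entourages X) \<and> (\<forall>n\<ge>1. \<forall>x\<in>topspace X. \<phi> n x \<ge> 1)}"
  by (simp only: base_family_def entourage_sum_eq reciprocal_sum_eq universal_uniformity_eq[OF assms])

lemma base_familyE:
  assumes "completely_regular_space X" "B \<in> base_family X"
  obtains V \<phi> where "\<And>n. n \<ge> 1 \<Longrightarrow> V n \<in> normal_entourages X"
    "\<And>n x. n \<ge> 1 \<Longrightarrow> x \<in> topspace X \<Longrightarrow> \<phi> n x \<ge> 1"
    "B = series_set (\<lambda>n. small_differences (V n)) + series_set (\<lambda>n. small_multiples (topspace X) (\<phi> n))"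
proof -
  obtain V \<phi> where "B = series_set (\<lambda>n. small_differences (V n)) + series_set (\<lambda>n. small_multiples (topspace X) (\<phi> n))"
    "\<forall>n\<ge>1. V n \<in> normal_entourages X" "\<forall>n\<ge>1. \<forall>x\<in>topspace X. \<phi> n x \<ge> 1"
    using assms(2) unfolding base_family_eq[OF assms(1)] by blast
  then show thesis by (intro that[of V \<phi>]) blast+
qed

lemma base_familyI:
  assumes "completely_regular_space X" "\<And>n. n \<ge> 1 \<Longrightarrow> V n \<in> normal_entourages X"
    "\<And>n x. n \<ge> 1 \<Longrightarrow> x \<in> topspace X \<Longrightarrow> \<phi> n x \<ge> 1"
  shows "series_set (\<lambda>n. small_differences (V n)) + series_set (\<lambda>n. small_multiples (topspace X) (\<phi> n))
    \<in> base_family X"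
  unfolding base_family_eq[OF assms(1)] using assms(2,3) by blast

context
  fixes X :: "'a topology"
  assumes creg: "completely_regular_space X" and nonempty: "topspace X \<noteq> {}"
begin

lemma entourage_nonempty: "V \<in> normal_entourages X \<Longrightarrow> V \<noteq> {}"
  using normal_entourages_between[of V X] nonempty by blast

lemma entourage_terms:
  assumes "V \<in> normal_entourages X"
  shows "0 \<in> small_differences V" "small_differences V \<subseteq> free_vector_space (topspace X)"
  using zero_in_small_differences entourage_nonempty small_differences_subset
    normal_entourages_between assms by metis+

lemma base_family_directed:
  assumes "B \<in> base_family X" "C \<in> base_family X"
  shows "\<exists>D\<in>base_family X. D \<subseteq> B \<inter> C"
proof -
  let ?S = "topspace X"
  obtain V \<phi> where V: "\<And>n. n \<ge> 1 \<Longrightarrow> V n \<in> normal_entourages X"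
    and p: "\<And>n x. n \<ge> 1 \<Longrightarrow> x \<in> ?S \<Longrightarrow> \<phi> n x \<ge> 1"
    and B: "B = series_set (\<lambda>n. small_differences (V n)) + series_set (\<lambda>n. small_multiples ?S (\<phi> n))"
    using base_familyE[OF creg assms(1)] by metis
  obtain W \<psi> where W: "\<And>n. n \<ge> 1 \<Longrightarrow> W n \<in> normal_entourages X"
    and q: "\<And>n x. n \<ge> 1 \<Longrightarrow> x \<in> ?S \<Longrightarrow> \<psi> n x \<ge> 1"
    and C: "C = series_set (\<lambda>n. small_differences (W n)) + series_set (\<lambda>n. small_multiples ?S (\<psi> n))"
    using base_familyE[OF creg assms(2)] by metis
  let ?D = "series_set (\<lambda>n. small_differences (V n \<inter> W n)) +
    series_set (\<lambda>n. small_multiples ?S (\<lambda>x. max (\<phi> n x) (\<psi> n x)))"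
  have "?D \<in> base_family X"
    by (rule base_familyI[OF creg]) (use V W p in \<open>auto intro: normal_entourages_Int simp: le_max_iff_disj\<close>)
  moreover have "?D \<subseteq> B"
    unfolding B
    by (intro set_plus_mono2 series_set_mono small_differences_mono small_multiples_antimono) (use p in auto)
  moreover have "?D \<subseteq> C"
    unfolding C
    by (intro set_plus_mono2 series_set_mono small_differences_mono small_multiples_antimono) (use q in auto)
  ultimately show ?thesis by blast
qed

text \<open>Interleaving two sums sends the term of index \<open>n\<close> to the place \<open>2 n - 1\<close> or
  \<open>2 n\<close>, so its entourage must fit into those of both places, and its denominator must dominate
  theirs.\<close>

lemma base_family_halving:
  assumes "B \<in> base_family X"
  shows "\<exists>C\<in>base_family X. C + C \<subseteq> B"
proof -
  let ?S = "topspace X"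
  obtain V \<phi> where V: "\<And>n. n \<ge> 1 \<Longrightarrow> V n \<in> normal_entourages X"
    and p: "\<And>n x. n \<ge> 1 \<Longrightarrow> x \<in> ?S \<Longrightarrow> \<phi> n x \<ge> 1"
    and B: "B = series_set (\<lambda>n. small_differences (V n)) + series_set (\<lambda>n. small_multiples ?S (\<phi> n))"
    using base_familyE[OF creg assms(1)] by metis
  define W where "W n = V (2 * n - 1) \<inter> V (2 * n)" for n
  define \<psi> where "\<psi> n x = max (\<phi> (2 * n - 1) x) (\<phi> (2 * n) x)" for n x
  let ?E = "series_set (\<lambda>n. small_differences (W n))"
  let ?R = "series_set (\<lambda>n. small_multiples ?S (\<psi> n))"
  have W: "W n \<in> normal_entourages X" if "n \<ge> 1" for n
    unfolding W_def by (rule normal_entourages_Int) (use V that in auto)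
  have "?E + ?R \<in> base_family X"
  proof (rule base_familyI[OF creg W])
    show "1 \<le> \<psi> n x" if "n \<ge> 1" "x \<in> ?S" for n x
      using p[of "2 * n" x] that by (simp add: \<psi>_def)
  qed
  moreover have "?E + ?E \<subseteq> series_set (\<lambda>n. small_differences (V n))"
    by (rule series_set_interleave)
      (use entourage_terms(1)[OF W] in \<open>auto simp: W_def intro: subsetD[OF small_differences_mono, rotated]\<close>)
  moreover have "?R + ?R \<subseteq> series_set (\<lambda>n. small_multiples ?S (\<phi> n))"
  proof (rule series_set_interleave)
    fix n :: nat assume n: "n \<ge> 1"
    show "0 \<in> small_multiples ?S (\<psi> n)" by (rule zero_in_small_multiples[OF nonempty])
    show "small_multiples ?S (\<psi> n)
        \<subseteq> small_multiples ?S (\<phi> (2 * n - 1)) \<inter> small_multiples ?S (\<phi> (2 * n))"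
      by (intro Int_greatest small_multiples_antimono) (use p n in \<open>auto simp: \<psi>_def\<close>)
  qed
  ultimately have "(?E + ?E) + (?R + ?R) \<subseteq> B"
    unfolding B by (intro set_plus_mono2)
  then have "(?E + ?R) + (?E + ?R) \<subseteq> B"
    by (simp only: ac_simps)
  then show ?thesis using \<open>?E + ?R \<in> base_family X\<close> by blast
qed

lemma base_family_scale:
  assumes "B \<in> base_family X" "u \<in> B" "\<bar>c\<bar> \<le> 1"
  shows "c *\<^sub>R u \<in> B"
proof -
  obtain V \<phi> where
    B: "B = series_set (\<lambda>n. small_differences (V n)) + series_set (\<lambda>n. small_multiples (topspace X) (\<phi> n))"
    using base_familyE[OF creg assms(1)] by metis
  obtain v w where "u = v + w" "v \<in> series_set (\<lambda>n. small_differences (V n))"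
    "w \<in> series_set (\<lambda>n. small_multiples (topspace X) (\<phi> n))"
    using assms(2) unfolding B by (rule set_plus_elim)
  then show ?thesis
    unfolding B
    by (auto simp: scaleR_add_right
        intro!: set_plus_intro series_set_scale small_differences_scale small_multiples_scale assms(3))
qed

lemma base_family_subset:
  assumes "B \<in> base_family X"
  shows "B \<subseteq> free_vector_space (topspace X)"
proof -
  obtain V \<phi> where V: "\<And>n. n \<ge> 1 \<Longrightarrow> V n \<in> normal_entourages X" and
    B: "B = series_set (\<lambda>n. small_differences (V n)) + series_set (\<lambda>n. small_multiples (topspace X) (\<phi> n))"
    using base_familyE[OF creg assms(1)] by metis
  have "series_set (\<lambda>n. small_differences (V n)) \<subseteq> free_vector_space (topspace X)"
    "series_set (\<lambda>n. small_multiples (topspace X) (\<phi> n)) \<subseteq> free_vector_space (topspace X)"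
    by (intro series_set_subset_subspace subspace_free_vector_space entourage_terms(2)[OF V]
        small_multiples_subset; assumption)+
  then show ?thesis
    unfolding B using subspace_add[OF subspace_free_vector_space] by (blast elim!: set_plus_elim)
qed

lemma base_family_contains_series:
  assumes "\<And>n. n \<ge> 1 \<Longrightarrow> V n \<in> normal_entourages X"
  shows "series_set (\<lambda>n. small_differences (V n)) \<subseteq>
      series_set (\<lambda>n. small_differences (V n)) + series_set (\<lambda>n. small_multiples (topspace X) (\<phi> n))"
    and "series_set (\<lambda>n. small_multiples (topspace X) (\<phi> n)) \<subseteq>
      series_set (\<lambda>n. small_differences (V n)) + series_set (\<lambda>n. small_multiples (topspace X) (\<phi> n))"
proof -
  let ?E = "series_set (\<lambda>n. small_differences (V n))"
  let ?R = "series_set (\<lambda>n. small_multiples (topspace X) (\<phi> n))"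
  have zero: "0 \<in> ?E" "0 \<in> ?R"
    by (intro series_set_first entourage_terms(1) assms zero_in_small_multiples nonempty order_refl)+
  have "?E \<subseteq> ?R + ?E" using zero(2) by (rule set_zero_plus2)
  then show "?E \<subseteq> ?E + ?R" by (simp only: add.commute)
  show "?R \<subseteq> ?E + ?R" using zero(1) by (rule set_zero_plus2)
qed

text \<open>The vectors absorbed by all members of the family form a linear subspace, because members are
  balanced and can be halved. It contains the generators, hence everything.\<close>

lemma base_family_absorbing:
  assumes "B \<in> base_family X" "u \<in> free_vector_space (topspace X)"
  shows "\<exists>\<epsilon>>0. \<epsilon> *\<^sub>R u \<in> B"
proof -
  define A where "A = {u. \<forall>B\<in>base_family X. \<exists>\<epsilon>>0. \<epsilon> *\<^sub>R u \<in> B}"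
  have gens: "gen x \<in> A" if x: "x \<in> topspace X" for x
    unfolding A_def
  proof (intro CollectI ballI)
    fix B assume B: "B \<in> base_family X"
    obtain V \<phi> where V: "\<And>n. n \<ge> 1 \<Longrightarrow> V n \<in> normal_entourages X"
      and p: "\<And>n x. n \<ge> 1 \<Longrightarrow> x \<in> topspace X \<Longrightarrow> \<phi> n x \<ge> 1"
      and B: "B = series_set (\<lambda>n. small_differences (V n)) + series_set (\<lambda>n. small_multiples (topspace X) (\<phi> n))"
      using base_familyE[OF creg B] by metis
    have "(1 / real (\<phi> 1 x)) *\<^sub>R gen x \<in> series_set (\<lambda>n. small_multiples (topspace X) (\<phi> n))"
      by (intro series_set_first small_multiplesI x) simp
    then have "(1 / real (\<phi> 1 x)) *\<^sub>R gen x \<in> B"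
      unfolding B using base_family_contains_series(2)[of V, OF V] by blast
    moreover have "1 / real (\<phi> 1 x) > 0" using p[of 1 x] x by simp
    ultimately show "\<exists>\<epsilon>>0. \<epsilon> *\<^sub>R gen x \<in> B" by blast
  qed
  have "subspace A"
  proof (rule subspaceI)
    show "0 \<in> A"
      unfolding A_def
    proof (intro CollectI ballI)
      fix B assume B: "B \<in> base_family X"
      obtain x where "x \<in> topspace X" using nonempty by blast
      then obtain \<epsilon> where \<epsilon>: "\<epsilon> *\<^sub>R gen x \<in> B" using gens B unfolding A_def by blast
      have "0 *\<^sub>R \<epsilon> *\<^sub>R gen x \<in> B" by (rule base_family_scale[OF B \<epsilon>]) simp
      then show "\<exists>\<epsilon>>0. \<epsilon> *\<^sub>R 0 \<in> B" by (intro exI[of _ 1]) simp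
    qed
    show "u + v \<in> A" if uv: "u \<in> A" "v \<in> A" for u v
      unfolding A_def
    proof (intro CollectI ballI)
      fix B assume B: "B \<in> base_family X"
      obtain C where C: "C \<in> base_family X" "C + C \<subseteq> B" using base_family_halving[OF B] by blast
      obtain d e where de: "d > 0" "d *\<^sub>R u \<in> C" "e > 0" "e *\<^sub>R v \<in> C"
        using uv C(1) unfolding A_def by blast
      have "(min d e / d) *\<^sub>R d *\<^sub>R u \<in> C" "(min d e / e) *\<^sub>R e *\<^sub>R v \<in> C"
        by (rule base_family_scale[OF C(1) de(2)] base_family_scale[OF C(1) de(4)];
            use de in simp)+
      then have "min d e *\<^sub>R u + min d e *\<^sub>R v \<in> C + C"
        using de by (intro set_plus_intro) simp_all
      then have "min d e *\<^sub>R (u + v) \<in> B" using C(2) by (auto simp: scaleR_add_right)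
      then show "\<exists>\<epsilon>>0. \<epsilon> *\<^sub>R (u + v) \<in> B" using de by (intro exI[of _ "min d e"]) simp
    qed
    show "c *\<^sub>R u \<in> A" if u: "u \<in> A" for c u
      unfolding A_def
    proof (intro CollectI ballI)
      fix B assume B: "B \<in> base_family X"
      obtain d where d: "d > 0" "d *\<^sub>R u \<in> B" using u B unfolding A_def by blast
      \<comment> \<open>Adding one avoids a case distinction for \<open>c = 0\<close>.\<close>
      have "(c / (\<bar>c\<bar> + 1)) *\<^sub>R d *\<^sub>R u \<in> B"
        by (rule base_family_scale[OF B d(2)]) (simp add: divide_le_eq)
      then have "(d / (\<bar>c\<bar> + 1)) *\<^sub>R c *\<^sub>R u \<in> B" by (simp add: mult.commute)
      moreover have "d / (\<bar>c\<bar> + 1) > 0" using d(1) by simp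
      ultimately show "\<exists>\<epsilon>>0. \<epsilon> *\<^sub>R c *\<^sub>R u \<in> B" by blast
    qed
  qed
  then have "lin_ext gen u \<in> A"
    by (rule lin_ext_in[OF _ _ assms(2)]) (use gens in blast)
  then show ?thesis using assms(1) by (simp add: lin_ext_gen_eq A_def)
qed

lemma zero_base_base_family: "zero_base (free_vector_space (topspace X)) (base_family X)"
proof
  have "topspace X \<times> topspace X \<in> normal_entourages X"
    using normal_sequence_member[of X "\<lambda>_. topspace X \<times> topspace X"]
    by (auto simp: normal_sequence_def sectionwise_nhood_def sym_def)
  then show "base_family X \<noteq> {}"
    using base_familyI[OF creg, of "\<lambda>_. topspace X \<times> topspace X" "\<lambda>_ _. 1"] by blast
qed (use subspace_free_vector_space base_family_subset base_family_directed base_family_halving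
      base_family_scale base_family_absorbing in auto)

text \<open>The family \<open>\<B>\<close> is either the base itself or the family of convex hulls. Around \<open>x\<close> it
  is enough to look at \<open>gen y - gen x\<close>, which is a single term of the first sum.\<close>

lemma continuous_map_gen_tvs_topology:
  assumes "zero_base (free_vector_space (topspace X)) \<B>" "\<And>B. B \<in> \<B> \<Longrightarrow> \<exists>C\<in>base_family X. C \<subseteq> B"
  shows "continuous_map X (zero_base.tvs_topology (free_vector_space (topspace X)) \<B>) gen"
proof -
  interpret zero_base "free_vector_space (topspace X)" \<B> by (rule assms(1))
  show ?thesis
    unfolding continuous_map_def
  proof (intro conjI allI impI)
    show "gen \<in> topspace X \<rightarrow> topspace tvs_topology"
      by (simp add: topspace_tvs_topology gen_in_free_vector_space)
    fix U assume U: "openin tvs_topology U"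
    show "openin X {x \<in> topspace X. gen x \<in> U}"
    proof (rule openin_if_sections)
      fix x assume x: "x \<in> {x \<in> topspace X. gen x \<in> U}"
      then obtain B where B: "B \<in> \<B>" "\<forall>b\<in>B. gen x + b \<in> U"
        using U by (auto simp: openin_tvs_topology)
      obtain C where C: "C \<in> base_family X" "C \<subseteq> B" using assms(2)[OF B(1)] by blast
      obtain V \<phi> where V: "\<And>n. n \<ge> 1 \<Longrightarrow> V n \<in> normal_entourages X"
        and CV: "C = series_set (\<lambda>n. small_differences (V n)) + series_set (\<lambda>n. small_multiples (topspace X) (\<phi> n))"
        using base_familyE[OF creg C(1)] by metis
      have "gen y \<in> U \<and> y \<in> topspace X" if y: "(x, y) \<in> V 1" for y
      proof -
        have "(-1) *\<^sub>R (gen x - gen y) \<in> series_set (\<lambda>n. small_differences (V n))"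
          by (intro series_set_first small_differencesI y) simp
        then have "gen y - gen x \<in> C"
          unfolding CV using base_family_contains_series(1)[of V, OF V] by (simp add: subset_iff)
        then have "gen x + (gen y - gen x) \<in> U" using B(2) C(2) by blast
        moreover have "y \<in> topspace X" using normal_entourages_between[OF V[of 1]] y by blast
        ultimately show ?thesis by simp
      qed
      then show "\<exists>V\<in>normal_entourages X. V `` {x} \<subseteq> {x \<in> topspace X. gen x \<in> U}"
        using V[of 1] by (intro bexI[of _ "V 1"]) auto
    qed blast
  qed
qed

end

section \<open>The sums lie below every neighbourhood of zero\<close>

lemma pointwise_multiples_inside:
  assumes "tvs E" "continuous_map X E gen" "openin E W" "0 \<in> W"
  shows "\<exists>\<phi>. (\<forall>x\<in>topspace X. \<phi> x \<ge> 1) \<and> small_multiples (topspace X) \<phi> \<subseteq> W"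
proof -
  have "\<forall>x\<in>topspace X. \<exists>k::nat\<ge>1. \<forall>t. \<bar>t\<bar> \<le> 1 / real k \<longrightarrow> t *\<^sub>R gen x \<in> W"
    using scalar_multiples_small[OF assms(1) _ assms(3,4)]
      continuous_map_image_subset_topspace[OF assms(2)] by blast
  then obtain \<phi> where "\<forall>x\<in>topspace X. \<phi> x \<ge> (1::nat) \<and> (\<forall>t. \<bar>t\<bar> \<le> 1 / real (\<phi> x) \<longrightarrow> t *\<^sub>R gen x \<in> W)"
    by metis
  then show ?thesis
    by (intro exI[of _ \<phi>]) (auto simp: small_multiples_def)
qed

text \<open>Every \<open>y\<close> differs by a vector of \<open>N\<close> from one of finitely many points \<open>x\<close>. For
  these a common bound on \<open>t\<close> puts \<open>t x\<close> into \<open>N\<close>, and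
  \<open>t y = t x - t (x - y)\<close>.\<close>

lemma uniform_multiples_inside:
  assumes "completely_regular_space X" "pseudocompact_space X"
    and E: "tvs E" and gen: "continuous_map X E gen" and W: "openin E W" "0 \<in> W"
  shows "\<exists>k\<ge>1. small_multiples (topspace X) (\<lambda>_. k) \<subseteq> W"
proof -
  obtain N where N: "openin E N" "0 \<in> N"
    "\<And>u v c d. u \<in> N \<Longrightarrow> v \<in> N \<Longrightarrow> \<bar>c\<bar> \<le> 1 \<Longrightarrow> \<bar>d\<bar> \<le> 1 \<Longrightarrow> c *\<^sub>R u + d *\<^sub>R v \<in> W"
    using tvs_smaller_nhood[OF E W] by metis
  obtain F where F: "finite F" "F \<subseteq> topspace X"
    "topspace X \<subseteq> {(x, y) \<in> topspace X \<times> topspace X. gen x - gen y \<in> N} `` F"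
    using pseudocompact_totally_bounded[OF assms(1,2) difference_entourage[OF E gen N(1,2)]] by blast
  obtain \<phi> where p: "\<forall>x\<in>topspace X. \<phi> x \<ge> 1" "small_multiples (topspace X) \<phi> \<subseteq> N"
    using pointwise_multiples_inside[OF E gen N(1,2)] by blast
  \<comment> \<open>The sum dominates every \<open>\<phi> x\<close>; the successor also covers empty \<open>F\<close>.\<close>
  define k where "k = Suc (\<Sum>x\<in>F. \<phi> x)"
  have k1: "k \<ge> 1" by (simp add: k_def)
  have "small_multiples (topspace X) (\<lambda>_. k) \<subseteq> W"
  proof
    fix v assume "v \<in> small_multiples (topspace X) (\<lambda>_. k)"
    then obtain t y where v: "v = t *\<^sub>R gen y" "y \<in> topspace X" "\<bar>t\<bar> \<le> 1 / real k"
      unfolding small_multiples_def by blast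
    obtain x where x: "x \<in> F" "gen x - gen y \<in> N" using F(3) v(2) by blast
    have "\<phi> x \<le> k"
      unfolding k_def using member_le_sum[OF x(1), of \<phi>] F(1) by simp
    moreover have "\<phi> x \<ge> 1" using p(1) F(2) x(1) by blast
    ultimately have "1 / real k \<le> 1 / real (\<phi> x)"
      by (intro divide_left_mono) auto
    then have "t *\<^sub>R gen x \<in> N"
      using p(2) small_multiplesI[of x "topspace X" t \<phi>] F(2) x(1) v(3) by fastforce
    moreover have "\<bar>t\<bar> \<le> 1"
    proof -
      have "1 / real k \<le> 1" using k1 by simp
      then show ?thesis using v(3) by linarith
    qed
    ultimately have "1 *\<^sub>R (t *\<^sub>R gen x) + (- t) *\<^sub>R (gen x - gen y) \<in> W"
      using x(2) by (intro N(3)) auto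
    then show "v \<in> W" by (simp add: v(1) algebra_simps)
  qed
  then show ?thesis using k1 by blast
qed

text \<open>Each of the two sums is kept inside \<open>U 1\<close>, so that together they stay in \<open>U 0\<close>.
  The entourages use one index more, to make room for the scalar factors.\<close>

lemma sums_inside:
  assumes E: "tvs E" and gen: "continuous_map X E gen" and U: "shrinking_nhoods E U"
    and \<phi>: "\<And>n. n \<ge> 1 \<Longrightarrow> small_multiples (topspace X) (\<phi> n) \<subseteq> U (Suc n)"
  shows "\<exists>V. (\<forall>n\<ge>1. V n \<in> normal_entourages X) \<and>
    entourage_sum V + reciprocal_sum (topspace X) \<phi> \<subseteq> U 0"
proof -
  define V where "V n = {(x, y) \<in> topspace X \<times> topspace X. gen x - gen y \<in> U (Suc (Suc n))}" for n
  have "V n \<in> normal_entourages X" for n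
    unfolding V_def
    by (rule difference_entourage[OF E gen]) (use U in \<open>simp_all add: shrinking_nhoods_def\<close>)
  moreover have "entourage_sum V \<subseteq> U (Suc 0)"
    unfolding entourage_sum_eq
  proof (rule shrinking_nhoods_series[OF U])
    fix n :: nat
    show "small_differences (V n) \<subseteq> U (Suc 0 + n)"
      unfolding small_differences_def V_def by (auto intro: shrinking_nhoods_scale[OF U])
  qed
  moreover have "reciprocal_sum (topspace X) \<phi> \<subseteq> U (Suc 0)"
    unfolding reciprocal_sum_eq
    by (rule shrinking_nhoods_series[OF U]) (use \<phi> in simp)
  ultimately show ?thesis
    by (intro exI[of _ V]) (auto elim!: set_plus_elim intro!: shrinking_nhoods_plus[OF U])
qed

lemma base_family_inside:
  assumes creg: "completely_regular_space X"
    and E: "tvs E" and gen: "continuous_map X E gen" and W: "openin E W" "0 \<in> W"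
  shows "\<exists>B\<in>base_family X. B \<subseteq> W"
proof -
  obtain U where U: "shrinking_nhoods E U" "U 0 = W"
    using tvs_shrinking_nhoods[OF E W] .
  have "\<forall>n. \<exists>\<phi>. (\<forall>x\<in>topspace X. \<phi> x \<ge> 1) \<and> small_multiples (topspace X) \<phi> \<subseteq> U (Suc n)"
    by (intro allI pointwise_multiples_inside[OF E gen])
      (use U(1) in \<open>simp_all add: shrinking_nhoods_def\<close>)
  then obtain \<phi> where p: "\<And>n x. x \<in> topspace X \<Longrightarrow> \<phi> n x \<ge> (1::nat)"
    "\<And>n. small_multiples (topspace X) (\<phi> n) \<subseteq> U (Suc n)" by metis
  obtain V where "\<forall>n\<ge>1. V n \<in> normal_entourages X"
    "entourage_sum V + reciprocal_sum (topspace X) \<phi> \<subseteq> W"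
    using sums_inside[OF E gen U(1), of \<phi>] p(2) U(2) by blast
  then show ?thesis
    unfolding base_family_def universal_uniformity_eq[OF creg]
    by (intro bexI[of _ "entourage_sum V + reciprocal_sum (topspace X) \<phi>"] CollectI exI conjI)
      (use p(1) in auto)
qed

lemma base_family_const_inside:
  assumes creg: "completely_regular_space X" and pc: "pseudocompact_space X"
    and E: "tvs E" and gen: "continuous_map X E gen" and W: "openin E W" "0 \<in> W"
  shows "\<exists>B\<in>base_family_const X. B \<subseteq> W"
proof -
  obtain U where U: "shrinking_nhoods E U" "U 0 = W"
    using tvs_shrinking_nhoods[OF E W] .
  have "\<forall>n. \<exists>k\<ge>1. small_multiples (topspace X) (\<lambda>_. k) \<subseteq> U (Suc n)"
    by (intro allI uniform_multiples_inside[OF creg pc E gen])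
      (use U(1) in \<open>simp_all add: shrinking_nhoods_def\<close>)
  then obtain k where k: "\<And>n. k n \<ge> (1::nat)"
    "\<And>n. small_multiples (topspace X) (\<lambda>_. k n) \<subseteq> U (Suc n)" by metis
  obtain V where "\<forall>n\<ge>1. V n \<in> normal_entourages X"
    "entourage_sum V + reciprocal_sum (topspace X) (\<lambda>n _. k n) \<subseteq> W"
    using sums_inside[OF E gen U(1), of "\<lambda>n _. k n"] k(2) U(2) by blast
  then show ?thesis
    unfolding base_family_const_def universal_uniformity_eq[OF creg]
    by (intro bexI[of _ "entourage_sum V + reciprocal_sum (topspace X) (\<lambda>n _. k n)"] CollectI exI conjI)
      (use k(1) in auto)
qed

lemma base_family_const_subset: "base_family_const X \<subseteq> base_family X"
  unfolding base_family_const_def base_family_def by blast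

lemma convex_hulls_inside:
  assumes "lcs E" "\<And>W. openin E W \<Longrightarrow> 0 \<in> W \<Longrightarrow> \<exists>B\<in>\<B>. B \<subseteq> W" "openin E W" "0 \<in> W"
  shows "\<exists>B\<in>(\<lambda>B. convex hull B) ` \<B>. B \<subseteq> W"
proof -
  obtain U C where C: "openin E U" "convex C" "0 \<in> U" "U \<subseteq> C" "C \<subseteq> W"
    using assms(1,3,4) unfolding lcs_def neighbourhood_base_at_def by meson
  obtain B where B: "B \<in> \<B>" "B \<subseteq> U" using assms(2)[OF C(1,3)] by blast
  have "convex hull B \<subseteq> C" by (rule hull_minimal) (use B C in auto)
  then show ?thesis using B(1) C(5) by blast
qed

section \<open>Neighbourhood bases of the free spaces\<close>

text \<open>The universal property, applied to the inclusion of \<open>X\<close> into the topology generated by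
  \<open>\<B>\<close>, says that the identity is continuous, that is, the free topology is finer. So members of
  \<open>\<B>\<close> are neighbourhoods of zero in it. The subfamily \<open>\<C>\<close> is there for the sums
  with constant denominators, which inherit from \<open>\<B>\<close> that they are neighbourhoods.\<close>

lemma nhood_base_free_over:
  assumes free: "free_over P X \<mu>"
    and \<B>: "zero_base (free_vector_space (topspace X)) \<B>"
    and P: "P (zero_base.tvs_topology (free_vector_space (topspace X)) \<B>)"
    and gen: "continuous_map X (zero_base.tvs_topology (free_vector_space (topspace X)) \<B>) gen"
    and sub: "\<C> \<subseteq> \<B>"
    and inside: "\<And>U. openin \<mu> U \<Longrightarrow> 0 \<in> U \<Longrightarrow> \<exists>B\<in>\<C>. B \<subseteq> U"
  shows "nhood_base_at \<mu> 0 \<C>"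
proof -
  interpret zero_base "free_vector_space (topspace X)" \<B> by (rule \<B>)
  have top: "topspace \<mu> = free_vector_space (topspace X)"
    using free by (simp add: free_over_def)
  have "uniquely_extends X \<mu> tvs_topology"
    using free P by (simp add: free_over_def)
  from uniquely_extendsD[OF top this gen] have id: "continuous_map \<mu> tvs_topology id"
    by (simp add: lin_ext_gen_id)
  have coarser: "openin \<mu> U" if U: "openin tvs_topology U" for U
  proof -
    have "openin \<mu> {p \<in> topspace \<mu>. id p \<in> U}"
      using id U by (rule openin_continuous_map_preimage)
    moreover have "{p \<in> topspace \<mu>. id p \<in> U} = U"
      using openin_subset[OF U] by (auto simp: top topspace_tvs_topology)
    ultimately show ?thesis by simp
  qed
  show ?thesis
    unfolding nhood_base_at_def
  proof (intro conjI ballI allI impI)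
    fix B assume "B \<in> \<C>"
    then have B: "B \<in> \<B>" using sub by blast
    show "B \<subseteq> topspace \<mu>" using subset[OF B] top by simp
    obtain U where "openin tvs_topology U" "0 \<in> U" "U \<subseteq> B"
      using nhood_base_tvs_topology B unfolding nhood_base_at_def by meson
    then show "\<exists>U. openin \<mu> U \<and> 0 \<in> U \<and> U \<subseteq> B" using coarser by blast
  next
    fix U assume "openin \<mu> U \<and> 0 \<in> U"
    then show "\<exists>B\<in>\<C>. B \<subseteq> U" using inside by blast
  qed
qed

theorem theorem1:
  fixes X :: "'a topology"
  assumes "completely_regular_space X" and "Hausdorff_space X" and "topspace X \<noteq> {}"
  shows "nhood_base_at (free_tvs X) 0 (base_family X) \<and>
         nhood_base_at (free_lcs X) 0 ((\<lambda>W. convex hull W) ` base_family X) \<and>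
         (pseudocompact_space X \<longrightarrow>
            nhood_base_at (free_tvs X) 0 (base_family_const X) \<and>
            nhood_base_at (free_lcs X) 0 ((\<lambda>W. convex hull W) ` base_family_const X))"
proof -
  let ?T = "free_vector_space (topspace X)" and ?H = "\<lambda>\<C>. (\<lambda>W. convex hull W) ` \<C>"
  note creg = assms(1)
  have base: "zero_base ?T (base_family X)"
    by (rule zero_base_base_family[OF creg assms(3)])
  have hulls: "zero_base ?T (?H (base_family X))"
    by (rule zero_base.zero_base_convex_hulls[OF base])
  have genV: "continuous_map X (zero_base.tvs_topology ?T (base_family X)) gen"
    by (rule continuous_map_gen_tvs_topology[OF creg assms(3) base]) blast
  have genL: "continuous_map X (zero_base.tvs_topology ?T (?H (base_family X))) gen"
    by (rule continuous_map_gen_tvs_topology[OF creg assms(3) hulls]) (erule imageE, hypsubst, rule bexI, rule hull_subset, assumption)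
  have tvsV: "tvs (zero_base.tvs_topology ?T (base_family X))"
    by (rule zero_base.tvs_tvs_topology[OF base])
  have lcsL: "lcs (zero_base.tvs_topology ?T (?H (base_family X)))"
    by (rule zero_base.lcs_tvs_topology[OF hulls]) auto
  have V: "tvs (free_tvs X)" "continuous_map X (free_tvs X) gen"
    using free_over_free_tvs[of X] by (simp_all add: free_over_def)
  have L: "lcs (free_lcs X)" "tvs (free_lcs X)" "continuous_map X (free_lcs X) gen"
    using free_over_free_lcs[of X] by (simp_all add: free_over_def lcs_def)
  have nhoodV: "nhood_base_at (free_tvs X) 0 \<C>"
    if "\<C> \<subseteq> base_family X" "\<And>U. openin (free_tvs X) U \<Longrightarrow> 0 \<in> U \<Longrightarrow> \<exists>B\<in>\<C>. B \<subseteq> U" for \<C>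
    by (rule nhood_base_free_over[OF free_over_free_tvs base tvsV genV that])
  have nhoodL: "nhood_base_at (free_lcs X) 0 (?H \<C>)"
    if "\<C> \<subseteq> base_family X" "\<And>U. openin (free_lcs X) U \<Longrightarrow> 0 \<in> U \<Longrightarrow> \<exists>B\<in>\<C>. B \<subseteq> U" for \<C>
    by (rule nhood_base_free_over[OF free_over_free_lcs hulls lcsL genL image_mono[OF that(1)]
          convex_hulls_inside[OF L(1) that(2)]])
  show ?thesis
  proof (intro conjI impI)
    show "nhood_base_at (free_tvs X) 0 (base_family X)"
      by (rule nhoodV[OF order_refl base_family_inside[OF creg V]])
    show "nhood_base_at (free_lcs X) 0 (?H (base_family X))"
      by (rule nhoodL[OF order_refl base_family_inside[OF creg L(2,3)]])
    assume pc: "pseudocompact_space X"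
    show "nhood_base_at (free_tvs X) 0 (base_family_const X)"
      by (rule nhoodV[OF base_family_const_subset base_family_const_inside[OF creg pc V]])
    show "nhood_base_at (free_lcs X) 0 (?H (base_family_const X))"
      by (rule nhoodL[OF base_family_const_subset base_family_const_inside[OF creg pc L(2,3)]])
  qed
qed

end
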